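(* Let $\Omega\subset\mathbb{R}^d$ be a bounded Lipschitz domain and let $K,R,\tilde R$ be kernels satisfying the kernel assumptions stated in the context. Then for arbitrary fixed constants $\delta_n>0$ and $\xi_n>0$, there exists a unique minimizer of the functional $F_n:L^2(\Omega)\to\mathbb{R}$ defined in the context.
   Context: Data: $f\in L^2(\Omega)$; $a$ and $b$ are the trace and the normal derivative on $\partial\Omega$ of an $H^2(\Omega)$ function ($n$ is the outward unit normal). Surface measure on $\partial\Omega$ is denoted $dS$. Kernel assumptions: $K,R:[0,\infty)\to[0,\infty)$ are $C^1$, monotonically decreasing, with $\mathrm{supp}(K)\subset[0,r_K^2/4]$ and $\mathrm{supp}(R)\subset[0,r_R^2/4]$ for given constants $r_K,r_R>0$; $\tilde R$ is a further kernel of the same type, which does not enter $F_n$. Put $\bar R(s)=\int_s^\infty R(t)\,dt$ for $s\ge 0$. For $\delta>0$ the scaled kernels are $R_\delta(x,y)=\delta^{-d}R\big(\tfrac{|x-y|^2}{4\delta^2}\big)$, $\bar R_\delta(x,y)=\delta^{-d}\bar R\big(\tfrac{|x-y|^2}{4\delta^2}\big)$, $K_\delta(x,y)=\delta^{-d}K\big(\tfrac{|x-y|^2}{4\delta^2}\big)$. For $u\in L^2(\Omega)$, $$F_n(u)=\int_\Omega\Big|\frac{1}{\delta_n^2}\int_\Omega R_{\delta_n}(x,y)(u(x)-u(y))\,dy-2\int_{\partial\Omega}\bar R_{\delta_n}(x,y)b(y)\,dS(y)\Big|^2dx-2\int_\Omega fu\,dx+B_n(u,a),$$ $$B_n(u,a)=\frac1{\xi_n}\int_{\partial\Omega}\Big|\int_\Omega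 K_{\delta_n}(x,y)(a(x)-u(y))\,dy\Big|^2dS(x).$$
   Formalization: The kernels K and R are additionally assumed not identically zero on [0,∞); the stated kernel assumptions allow K = 0 or R = 0, for which a unique minimizer fails (e.g. K = 0 and f = a = b = 0: every constant minimizes F_n). *)

theory Defs
  imports "HOL-Analysis.Analysis"
begin

text \<open>
  Throughout, the ambient space is a Euclidean space of dimension \<open>d = DIM('a)\<close>.

  Hausdorff measure of integer dimension \<open>s\<close>, normalised so that it agrees with the
  usual \<open>s\<close>-dimensional area; \<open>s = 0\<close> gives the counting measure (the empty set has to be
  treated separately because \<open>0 ^ 0 = 1\<close>).
\<close>

definition hausdorff_weight :: "nat \<Rightarrow> 'a::euclidean_space set \<Rightarrow> ennreal" where
  "hausdorff_weight s C =
     (if C = {} then 0 else ennreal (unit_ball_vol (real s) * (diameter C / 2) ^ s))"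

definition hausdorff_covers :: "real \<Rightarrow> 'a::euclidean_space set \<Rightarrow> (nat \<Rightarrow> 'a set) set" where
  "hausdorff_covers \<epsilon> A =
     {C. A \<subseteq> (\<Union>i. C i) \<and> (\<forall>i. bounded (C i) \<and> diameter (C i) \<le> \<epsilon>)}"

definition hausdorff_content :: "nat \<Rightarrow> real \<Rightarrow> 'a::euclidean_space set \<Rightarrow> ennreal" where
  "hausdorff_content s \<epsilon> A = (INF C\<in>hausdorff_covers \<epsilon> A. \<Sum>i. hausdorff_weight s (C i))"

definition hausdorff_outer :: "nat \<Rightarrow> 'a::euclidean_space set \<Rightarrow> ennreal" where
  "hausdorff_outer s A = (SUP \<epsilon>\<in>{0<..}. hausdorff_content s \<epsilon> A)"

definition hausdorff_measure :: "nat \<Rightarrow> 'a::euclidean_space measure" where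
  "hausdorff_measure s = measure_of UNIV (sets borel) (hausdorff_outer s)"

text \<open>
  A \<open>measure_of\<close> is the zero measure unless its third argument is countably additive; the
  lemma \<open>emeasure_hausdorff_measure\<close> below excludes this.
\<close>

lemma hausdorff_weight_empty [simp]: "hausdorff_weight s {} = 0"
  by (simp add: hausdorff_weight_def)

lemma hausdorff_content_le:
  assumes "A \<subseteq> (\<Union>i. C i)" "\<And>i. bounded (C i)" "\<And>i. diameter (C i) \<le> \<epsilon>"
  shows "hausdorff_content s \<epsilon> A \<le> (\<Sum>i. hausdorff_weight s (C i))"
  unfolding hausdorff_content_def
  by (rule INF_lower) (use assms in \<open>auto simp: hausdorff_covers_def\<close>)

lemma hausdorff_content_mono:
  "A \<subseteq> B \<Longrightarrow> hausdorff_content s \<epsilon> A \<le> hausdorff_content s \<epsilon> B"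
  unfolding hausdorff_content_def
  by (rule INF_superset_mono) (auto simp: hausdorff_covers_def)

lemma hausdorff_content_antimono:
  "\<epsilon> \<le> \<epsilon>' \<Longrightarrow> hausdorff_content s \<epsilon>' A \<le> hausdorff_content s \<epsilon> A"
  unfolding hausdorff_content_def
  by (rule INF_superset_mono) (auto simp: hausdorff_covers_def intro: order_trans)

lemma hausdorff_content_le_outer:
  "\<epsilon> > 0 \<Longrightarrow> hausdorff_content s \<epsilon> A \<le> hausdorff_outer s A"
  unfolding hausdorff_outer_def by (rule SUP_upper) auto

lemma hausdorff_outer_mono: "A \<subseteq> B \<Longrightarrow> hausdorff_outer s A \<le> hausdorff_outer s B"
  unfolding hausdorff_outer_def by (rule SUP_mono) (use hausdorff_content_mono in blast)

lemma hausdorff_outer_empty [simp]: "hausdorff_outer s {} = 0"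
proof -
  have "hausdorff_content s \<epsilon> {} \<le> 0" if "\<epsilon> > 0" for \<epsilon>
    using hausdorff_content_le[of "{}" "\<lambda>_. {}" \<epsilon> s] that by simp
  then have "hausdorff_outer s {} \<le> 0"
    unfolding hausdorff_outer_def by (intro SUP_least) auto
  then show ?thesis by simp
qed

lemma hausdorff_content_countable_subadditive:
  "hausdorff_content s \<epsilon> (\<Union>n. A n) \<le> (\<Sum>n. hausdorff_content s \<epsilon> (A n))"
proof (rule ennreal_le_epsilon)
  fix e :: real assume e: "0 < e" and fin: "(\<Sum>n. hausdorff_content s \<epsilon> (A n)) < top"
  let ?H = "hausdorff_content s \<epsilon>"
  have lt: "?H (A n) < ?H (A n) + e * (1/2) ^ Suc n" for n
    using fin e by (auto simp: less_top dest!: ennreal_suminf_lessD)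
  have "\<exists>C. C \<in> hausdorff_covers \<epsilon> (A n) \<and>
          (\<Sum>i. hausdorff_weight s (C i)) \<le> ?H (A n) + e * (1/2) ^ Suc n" for n
    using lt[of n] unfolding hausdorff_content_def[of s \<epsilon> "A n"] INF_less_iff
    by (meson less_imp_le)
  then obtain B where B: "\<And>n. B n \<in> hausdorff_covers \<epsilon> (A n)"
    and Ble: "\<And>n. (\<Sum>i. hausdorff_weight s (B n i)) \<le> ?H (A n) + e * (1/2) ^ Suc n"
    by metis
  define C where "C = case_prod B o prod_decode"
  have "(\<Union>n. A n) \<subseteq> (\<Union>i. C i)"
  proof
    fix x assume "x \<in> (\<Union>n. A n)"
    then obtain n i where "x \<in> B n i"
      using B unfolding hausdorff_covers_def by blast
    then have "x \<in> C (prod_encode (n, i))" by (simp add: C_def)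
    then show "x \<in> (\<Union>i. C i)" by blast
  qed
  moreover have "bounded (C i) \<and> diameter (C i) \<le> \<epsilon>" for i
    using B unfolding C_def hausdorff_covers_def by (auto split: prod.split)
  ultimately have "?H (\<Union>n. A n) \<le> (\<Sum>i. hausdorff_weight s (C i))"
    by (intro hausdorff_content_le) auto
  also have "\<dots> = (\<Sum>n. \<Sum>i. hausdorff_weight s (B n i))"
    using suminf_ennreal_2dimen[of "\<lambda>n. \<Sum>i. hausdorff_weight s (B n i)"
        "\<lambda>p. hausdorff_weight s (case_prod B p)"]
    by (simp add: C_def comp_def)
  also have "\<dots> \<le> (\<Sum>n. ?H (A n) + e * (1/2) ^ Suc n)"
    by (intro suminf_le allI Ble) auto
  also have "\<dots> = (\<Sum>n. ?H (A n)) + (\<Sum>n. ennreal e * ennreal ((1/2) ^ Suc n))"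
    using e by (subst suminf_add[symmetric])
      (auto simp del: ennreal_suminf_cmult simp add: ennreal_mult[symmetric])
  also have "\<dots> = (\<Sum>n. ?H (A n)) + e"
    unfolding ennreal_suminf_cmult
    by (subst suminf_ennreal_eq[OF zero_le_power power_half_series]) auto
  finally show "?H (\<Union>n. A n) \<le> (\<Sum>n. ?H (A n)) + e" .
qed

lemma hausdorff_outer_countable_subadditive:
  "hausdorff_outer s (\<Union>n. A n) \<le> (\<Sum>n. hausdorff_outer s (A n))"
  unfolding hausdorff_outer_def[of s "\<Union>n. A n"]
proof (rule SUP_least)
  fix \<epsilon> :: real assume "\<epsilon> \<in> {0<..}"
  then have "hausdorff_content s \<epsilon> (A n) \<le> hausdorff_outer s (A n)" for n
    by (auto intro: hausdorff_content_le_outer)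
  then have "(\<Sum>n. hausdorff_content s \<epsilon> (A n)) \<le> (\<Sum>n. hausdorff_outer s (A n))"
    by (intro suminf_le) auto
  with hausdorff_content_countable_subadditive
  show "hausdorff_content s \<epsilon> (\<Union>n. A n) \<le> (\<Sum>n. hausdorff_outer s (A n))"
    by (rule order_trans)
qed

lemma hausdorff_outer_measure_space: "outer_measure_space UNIV (hausdorff_outer s)"
  unfolding outer_measure_space_def positive_def increasing_def countably_subadditive_def
  using hausdorff_outer_mono hausdorff_outer_countable_subadditive by auto

lemma hausdorff_outer_Un: "hausdorff_outer s (A \<union> B) \<le> hausdorff_outer s A + hausdorff_outer s B"
proof -
  let ?F = "\<lambda>n::nat. if n = 0 then A else if n = 1 then B else {}"
  have "(\<Union>n. ?F n) = A \<union> B" by (auto split: if_splits)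
  moreover have "(\<Sum>n. hausdorff_outer s (?F n)) = (\<Sum>n\<in>{0,1}. hausdorff_outer s (?F n))"
    by (rule suminf_finite) auto
  ultimately show ?thesis
    using hausdorff_outer_countable_subadditive[of s ?F] by simp
qed

lemma hausdorff_outer_separated:
  fixes A B :: "'a::euclidean_space set"
  assumes "r > 0" and sep: "\<And>x y. x \<in> A \<Longrightarrow> y \<in> B \<Longrightarrow> r \<le> dist x y"
  shows "hausdorff_outer s A + hausdorff_outer s B \<le> hausdorff_outer s (A \<union> B)"
proof -
  have small: "hausdorff_content s \<epsilon> A + hausdorff_content s \<epsilon> B \<le> hausdorff_content s \<epsilon> (A \<union> B)"
    if \<epsilon>: "0 < \<epsilon>" "\<epsilon> < r" for \<epsilon>
    unfolding hausdorff_content_def[of s \<epsilon> "A \<union> B"]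
  proof (rule INF_greatest)
    fix C assume "C \<in> hausdorff_covers \<epsilon> (A \<union> B)"
    then have cov: "A \<union> B \<subseteq> (\<Union>i. C i)" and bd: "\<And>i. bounded (C i)"
      and di: "\<And>i. diameter (C i) \<le> \<epsilon>"
      by (auto simp: hausdorff_covers_def)
    let ?P = "\<lambda>S i. if C i \<inter> S = {} then {} else C i"
    have P: "hausdorff_content s \<epsilon> S \<le> (\<Sum>i. hausdorff_weight s (?P S i))" if "S \<subseteq> A \<union> B" for S
    proof (rule hausdorff_content_le)
      show "S \<subseteq> (\<Union>i. ?P S i)"
      proof
        fix x assume "x \<in> S"
        with that cov obtain i where "x \<in> C i" by blast
        with \<open>x \<in> S\<close> have "x \<in> ?P S i" by auto
        then show "x \<in> (\<Union>i. ?P S i)" by blast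
      qed
    qed (use bd di \<epsilon> in auto)
    have one: "C i \<inter> A = {} \<or> C i \<inter> B = {}" for i
    proof (rule ccontr)
      assume "\<not> ?thesis"
      then obtain x y where "x \<in> C i" "x \<in> A" "y \<in> C i" "y \<in> B" by blast
      with sep[of x y] diameter_bounded_bound[OF bd, of x i y] di[of i] \<epsilon> show False by auto
    qed
    have "hausdorff_content s \<epsilon> A + hausdorff_content s \<epsilon> B
        \<le> (\<Sum>i. hausdorff_weight s (?P A i)) + (\<Sum>i. hausdorff_weight s (?P B i))"
      by (intro add_mono P) auto
    also have "\<dots> = (\<Sum>i. hausdorff_weight s (?P A i) + hausdorff_weight s (?P B i))"
      by (rule suminf_add) auto
    also have "\<dots> \<le> (\<Sum>i. hausdorff_weight s (C i))"
    proof (rule suminf_le)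
      show "hausdorff_weight s (?P A i) + hausdorff_weight s (?P B i) \<le> hausdorff_weight s (C i)" for i
        using one[of i] by auto
    qed auto
    finally show "hausdorff_content s \<epsilon> A + hausdorff_content s \<epsilon> B
        \<le> (\<Sum>i. hausdorff_weight s (C i))" .
  qed
  have bnd: "hausdorff_content s \<epsilon> A + hausdorff_content s \<epsilon>' B \<le> hausdorff_outer s (A \<union> B)"
    if "0 < \<epsilon>" "0 < \<epsilon>'" for \<epsilon> \<epsilon>'
  proof -
    define \<eta> where "\<eta> = min (min \<epsilon> \<epsilon>') (r / 2)"
    have \<eta>: "0 < \<eta>" "\<eta> < r" "\<eta> \<le> \<epsilon>" "\<eta> \<le> \<epsilon>'" using that assms(1) by (auto simp: \<eta>_def)
    have "hausdorff_content s \<epsilon> A + hausdorff_content s \<epsilon>' B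
        \<le> hausdorff_content s \<eta> A + hausdorff_content s \<eta> B"
      by (intro add_mono hausdorff_content_antimono \<eta>)
    also have "\<dots> \<le> hausdorff_content s \<eta> (A \<union> B)" by (rule small) (use \<eta> in auto)
    also have "\<dots> \<le> hausdorff_outer s (A \<union> B)" by (rule hausdorff_content_le_outer) (use \<eta> in auto)
    finally show ?thesis .
  qed
  have ne: "{0<..} \<noteq> ({}::real set)" by (auto intro: gt_ex)
  have "hausdorff_outer s A + hausdorff_outer s B
      = (SUP \<epsilon>\<in>{0<..}. hausdorff_content s \<epsilon> A + hausdorff_outer s B)"
    unfolding hausdorff_outer_def[of s A]
    by (rule ennreal_SUP_add_left[OF ne, symmetric])
  also have "\<dots> \<le> hausdorff_outer s (A \<union> B)"
  proof (rule SUP_least)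
    fix \<epsilon> :: real assume \<epsilon>: "\<epsilon> \<in> {0<..}"
    have "hausdorff_content s \<epsilon> A + hausdorff_outer s B
        = (SUP \<epsilon>'\<in>{0<..}. hausdorff_content s \<epsilon> A + hausdorff_content s \<epsilon>' B)"
      unfolding hausdorff_outer_def[of s B]
      by (rule ennreal_SUP_add_right[OF ne])
    also have "\<dots> \<le> hausdorff_outer s (A \<union> B)"
      by (rule SUP_least) (use bnd \<epsilon> in auto)
    finally show "hausdorff_content s \<epsilon> A + hausdorff_outer s B \<le> hausdorff_outer s (A \<union> B)" .
  qed
  finally show ?thesis .
qed

lemma hausdorff_outer_sum_separated:
  fixes R :: "nat \<Rightarrow> 'a::euclidean_space set"
  assumes "\<And>i j. i < j \<Longrightarrow> \<exists>r>0. \<forall>x\<in>R i. \<forall>y\<in>R j. r \<le> dist x y"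
  shows "(\<Sum>i<n. hausdorff_outer s (R i)) \<le> hausdorff_outer s (\<Union>i<n. R i)"
proof (induction n)
  case (Suc n)
  have "\<exists>r>0. \<forall>x\<in>(\<Union>i<m. R i). \<forall>y\<in>R n. r \<le> dist x y" if "m \<le> n" for m
    using that
  proof (induction m)
    case 0
    show ?case by (rule exI[of _ 1]) auto
  next
    case (Suc m)
    then obtain r where r: "r > 0" "\<forall>x\<in>(\<Union>i<m. R i). \<forall>y\<in>R n. r \<le> dist x y" by auto
    obtain r' where r': "r' > 0" "\<forall>x\<in>R m. \<forall>y\<in>R n. r' \<le> dist x y"
      using assms[of m n] Suc.prems by auto
    show ?case
      by (rule exI[of _ "min r r'"]) (use r r' in \<open>auto simp: lessThan_Suc min_le_iff_disj\<close>)
  qed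
  then obtain r where "r > 0" "\<forall>x\<in>(\<Union>i<n. R i). \<forall>y\<in>R n. r \<le> dist x y" by blast
  then have "hausdorff_outer s (\<Union>i<n. R i) + hausdorff_outer s (R n)
      \<le> hausdorff_outer s ((\<Union>i<n. R i) \<union> R n)"
    by (intro hausdorff_outer_separated[of r]) auto
  moreover have "(\<Union>i<n. R i) \<union> R n = (\<Union>i<Suc n. R i)" by (auto simp: lessThan_Suc)
  ultimately show ?case
    unfolding sum.lessThan_Suc
    using order_trans[OF add_right_mono[OF Suc.IH, of "hausdorff_outer s (R n)"]] by simp
qed simp

lemma closed_in_hausdorff_lambda_system:
  fixes F :: "'a::euclidean_space set"
  assumes "closed F"
  shows "F \<in> lambda_system UNIV UNIV (hausdorff_outer s)"
proof (cases "F = {}")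
  case True
  then show ?thesis by (auto simp: lambda_system_def)
next
  case False
  have main: "hausdorff_outer s (T \<inter> F) + hausdorff_outer s (T - F) \<le> hausdorff_outer s T" for T
  proof (cases "hausdorff_outer s T = top")
    case fin: False
    define \<rho> where "\<rho> n = 1 / (real n + 1)" for n
    have \<rho>_pos: "\<rho> n > 0" for n by (simp add: \<rho>_def)
    have \<rho>_mono: "\<rho> n \<le> \<rho> m" if "m \<le> n" for m n
      using that by (auto simp: \<rho>_def field_simps)
    have \<rho>_less: "\<rho> n < \<rho> m" if "m < n" for m n
      using that by (auto simp: \<rho>_def field_simps)
    define S where "S n = {x\<in>T. \<rho> n \<le> infdist x F}" for n
    define D where "D k = {x\<in>T. \<rho> (Suc k) \<le> infdist x F \<and> infdist x F < \<rho> k}" for k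
    have D_sep: "\<exists>r>0. \<forall>x\<in>D i. \<forall>y\<in>D j. r \<le> dist x y" if "Suc i < j" for i j
    proof (intro exI conjI ballI)
      show "\<rho> (Suc i) - \<rho> j > 0" using \<rho>_less[OF that] by simp
      fix x y assume "x \<in> D i" "y \<in> D j"
      then have "\<rho> (Suc i) \<le> infdist x F" "infdist y F < \<rho> j" by (auto simp: D_def)
      moreover have "infdist x F \<le> infdist y F + dist x y" by (rule infdist_triangle)
      ultimately show "\<rho> (Suc i) - \<rho> j \<le> dist x y" by linarith
    qed
    have D_sub: "(\<Union>i\<in>I. D (g i)) \<subseteq> T" for I :: "nat set" and g :: "nat \<Rightarrow> nat" by (auto simp: D_def)
    have half: "(\<Sum>i. hausdorff_outer s (D (2 * i + c))) \<le> hausdorff_outer s T" for c :: nat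
    proof (rule suminf_le_const[OF summableI])
      fix n
      have "(\<Sum>i<n. hausdorff_outer s (D (2 * i + c))) \<le> hausdorff_outer s (\<Union>i<n. D (2 * i + c))"
        by (rule hausdorff_outer_sum_separated) (rule D_sep, simp)
      also have "\<dots> \<le> hausdorff_outer s T" by (rule hausdorff_outer_mono[OF D_sub])
      finally show "(\<Sum>i<n. hausdorff_outer s (D (2 * i + c))) \<le> hausdorff_outer s T" .
    qed
    have "(\<Sum>k. hausdorff_outer s (D k)) \<le> hausdorff_outer s T + hausdorff_outer s T"
    proof (rule suminf_le_const[OF summableI])
      fix n
      have "(\<Sum>k<n. hausdorff_outer s (D k)) \<le> (\<Sum>k<2 * n. hausdorff_outer s (D k))"
        by (rule sum_mono2) auto
      also have "\<dots> = (\<Sum>i<n. hausdorff_outer s (D (2 * i + 0))) + (\<Sum>i<n. hausdorff_outer s (D (2 * i + 1)))"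
        by (induction n) (auto simp: algebra_simps)
      also have "\<dots> \<le> (\<Sum>i. hausdorff_outer s (D (2 * i + 0))) + (\<Sum>i. hausdorff_outer s (D (2 * i + 1)))"
        by (intro add_mono sum_le_suminf) auto
      also have "\<dots> \<le> hausdorff_outer s T + hausdorff_outer s T"
        by (intro add_mono half)
      finally show "(\<Sum>k<n. hausdorff_outer s (D k)) \<le> hausdorff_outer s T + hausdorff_outer s T" .
    qed
    then have sum_fin: "(\<Sum>k. hausdorff_outer s (D k)) \<noteq> top"
      using fin by (metis ennreal_add_eq_top neq_top_trans)
    have cover: "hausdorff_outer s (T - F) \<le> hausdorff_outer s (S n) + (\<Sum>k. hausdorff_outer s (D (k + n)))"
      for n
    proof -
      have "T - F \<subseteq> S n \<union> (\<Union>k. D (k + n))"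
      proof
        fix x assume x: "x \<in> T - F"
        then have pos: "infdist x F > 0"
          using assms False by (metis DiffD2 in_closed_iff_infdist_zero infdist_pos_not_in_closed)
        show "x \<in> S n \<union> (\<Union>k. D (k + n))"
        proof (cases "\<rho> n \<le> infdist x F")
          case True
          with x show ?thesis by (auto simp: S_def)
        next
          case nle: False
          obtain m where m: "\<rho> m \<le> infdist x F"
            using reals_Archimedean[OF pos] unfolding \<rho>_def
            by (metis inverse_eq_divide less_imp_le of_nat_Suc add.commute)
          define p where "p = (LEAST m. \<rho> m \<le> infdist x F)"
          have p: "\<rho> p \<le> infdist x F" unfolding p_def using m by (rule LeastI)
          have "n < p" using nle p \<rho>_mono[of p n] by (meson not_less order_trans)
          then obtain q where q: "p = Suc q" "n \<le> q" by (metis Suc_le_D Suc_leI Suc_le_mono)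
          have "\<not> \<rho> q \<le> infdist x F" using not_less_Least[of q "\<lambda>m. \<rho> m \<le> infdist x F"] q p_def by auto
          then have "x \<in> D ((q - n) + n)" using x p q by (auto simp: D_def)
          then show ?thesis by blast
        qed
      qed
      then have "hausdorff_outer s (T - F) \<le> hausdorff_outer s (S n \<union> (\<Union>k. D (k + n)))"
        by (rule hausdorff_outer_mono)
      also have "\<dots> \<le> hausdorff_outer s (S n) + hausdorff_outer s (\<Union>k. D (k + n))"
        by (rule hausdorff_outer_Un)
      also have "\<dots> \<le> hausdorff_outer s (S n) + (\<Sum>k. hausdorff_outer s (D (k + n)))"
        by (intro add_left_mono hausdorff_outer_countable_subadditive)
      finally show ?thesis .
    qed
    have split: "hausdorff_outer s (T \<inter> F) + hausdorff_outer s (S n) \<le> hausdorff_outer s T" for n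
    proof -
      have "hausdorff_outer s (T \<inter> F) + hausdorff_outer s (S n) \<le> hausdorff_outer s ((T \<inter> F) \<union> S n)"
      proof (rule hausdorff_outer_separated[OF \<rho>_pos[of n]])
        fix x y assume "x \<in> T \<inter> F" "y \<in> S n"
        then have "\<rho> n \<le> infdist y F" "infdist y F \<le> dist y x"
          by (auto simp: S_def intro: infdist_le)
        then show "\<rho> n \<le> dist x y" by (simp add: dist_commute)
      qed
      also have "\<dots> \<le> hausdorff_outer s T" by (rule hausdorff_outer_mono) (auto simp: S_def)
      finally show ?thesis .
    qed
    let ?L = "hausdorff_outer s (T \<inter> F) + hausdorff_outer s (T - F)"
    let ?\<Sigma> = "\<Sum>k. hausdorff_outer s (D k)"
    have "?\<Sigma> + ?L \<le> hausdorff_outer s T + ?\<Sigma>"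
    proof (rule ennreal_suminf_bound_add)
      fix n
      have "(\<Sum>k<n. hausdorff_outer s (D k)) + ?L
          \<le> (\<Sum>k<n. hausdorff_outer s (D k)) +
            (hausdorff_outer s (T \<inter> F) + (hausdorff_outer s (S n) + (\<Sum>k. hausdorff_outer s (D (k + n)))))"
        by (intro add_left_mono cover)
      also have "\<dots> = (hausdorff_outer s (T \<inter> F) + hausdorff_outer s (S n)) +
          ((\<Sum>k. hausdorff_outer s (D (k + n))) + (\<Sum>k<n. hausdorff_outer s (D k)))"
        by (simp only: ac_simps)
      also have "\<dots> = (hausdorff_outer s (T \<inter> F) + hausdorff_outer s (S n)) + ?\<Sigma>"
        by (subst suminf_offset[of "\<lambda>k. hausdorff_outer s (D k)" n, OF summableI]) (rule refl)
      also have "\<dots> \<le> hausdorff_outer s T + ?\<Sigma>"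
        by (intro add_right_mono split)
      finally show "(\<Sum>k<n. hausdorff_outer s (D k)) + ?L \<le> hausdorff_outer s T + ?\<Sigma>" .
    qed
    then have "?\<Sigma> + ?L \<le> ?\<Sigma> + hausdorff_outer s T" by (simp only: add.commute)
    then show ?thesis
      using sum_fin by (subst (asm) ennreal_add_left_cancel_le) (auto simp: top.not_eq_extremum)
  qed simp
  have "hausdorff_outer s (F \<inter> T) + hausdorff_outer s ((UNIV - F) \<inter> T) = hausdorff_outer s T" for T
  proof (rule antisym)
    have "(UNIV - F) \<inter> T = T - F" by blast
    then show "hausdorff_outer s (F \<inter> T) + hausdorff_outer s ((UNIV - F) \<inter> T) \<le> hausdorff_outer s T"
      using main[of T] by (simp add: Int_commute)
    have "(F \<inter> T) \<union> ((UNIV - F) \<inter> T) = T" by blast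
    then show "hausdorff_outer s T \<le> hausdorff_outer s (F \<inter> T) + hausdorff_outer s ((UNIV - F) \<inter> T)"
      using hausdorff_outer_Un[of s "F \<inter> T" "(UNIV - F) \<inter> T"] by simp
  qed
  then show ?thesis by (auto simp: lambda_system_def)
qed

lemma sets_hausdorff_measure [simp, measurable_cong]:
  "sets (hausdorff_measure s :: 'a::euclidean_space measure) = sets borel"
  unfolding hausdorff_measure_def
  using sets.sigma_sets_eq[of "borel :: 'a measure"] by (simp add: sets_measure_of_conv)

lemma space_hausdorff_measure [simp]:
  "space (hausdorff_measure s :: 'a::euclidean_space measure) = UNIV"
  by (simp add: hausdorff_measure_def space_measure_of_conv)

lemma emeasure_hausdorff_measure:
  fixes A :: "'a::euclidean_space set"
  assumes "A \<in> sets borel"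
  shows "emeasure (hausdorff_measure s) A = hausdorff_outer s A"
proof -
  let ?L = "lambda_system UNIV UNIV (hausdorff_outer s :: 'a set \<Rightarrow> ennreal)"
  interpret sigma_algebra "UNIV :: 'a set" UNIV
    using sigma_algebra_Pow[of "UNIV :: 'a set"] by simp
  have ms: "measure_space UNIV ?L (hausdorff_outer s)"
    by (rule caratheodory_lemma[OF hausdorff_outer_measure_space])
  then interpret L: sigma_algebra UNIV ?L by (simp add: measure_space_def)
  have "sigma_sets UNIV {F :: 'a set. closed F} \<subseteq> ?L"
    by (rule L.sigma_sets_subset) (use closed_in_hausdorff_lambda_system in auto)
  moreover have "sets (borel :: 'a measure) = sigma_sets UNIV {F. closed F}"
    unfolding borel_eq_closed by (simp add: sets_measure_of_conv)
  ultimately have "sets borel \<subseteq> ?L" by simp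
  moreover have "sigma_algebra UNIV (sets (borel :: 'a measure))"
    using sets.sigma_algebra_axioms[of "borel :: 'a measure"] by simp
  ultimately have "measure_space UNIV (sets borel) (hausdorff_outer s :: 'a set \<Rightarrow> ennreal)"
    by (rule measure_down[OF ms, rotated])
  then show ?thesis
    unfolding hausdorff_measure_def measure_space_def using assms
    by (intro emeasure_measure_of_sigma) auto
qed

text \<open>
  Volume measure \<open>dx\<close> on \<open>\<Omega>\<close> and surface measure \<open>dS\<close> on its boundary.  Both live on Borel
  sets; this does not restrict \<open>L\<^sup>2\<close>, since every class of square integrable functions has
  a Borel representative.
\<close>

definition volume_on :: "'a::euclidean_space set \<Rightarrow> 'a measure" where
  "volume_on \<Omega> = restrict_space lborel \<Omega>"

definition surface_on :: "'a::euclidean_space set \<Rightarrow> 'a measure" where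
  "surface_on \<Omega> = restrict_space (hausdorff_measure (DIM('a) - 1)) (frontier \<Omega>)"

definition square_integrable :: "'a measure \<Rightarrow> ('a \<Rightarrow> real) set" where
  "square_integrable M = {u \<in> borel_measurable M. integrable M (\<lambda>x. (u x)\<^sup>2)}"

text \<open>
  In \<open>below_graph \<Omega> x r e \<gamma>\<close> the unit vector \<open>e\<close> is the last axis of a rotated orthonormal
  coordinate system, the hyperplane orthogonal to \<open>e\<close> is the space of the remaining
  coordinates, and \<open>\<Omega>\<close> is near \<open>x\<close> the region below the graph of \<open>\<gamma>\<close>.  Consequently the
  boundary of \<open>\<Omega>\<close> is the graph itself near \<open>x\<close>.
\<close>

definition drop_along :: "'a::euclidean_space \<Rightarrow> 'a \<Rightarrow> 'a" where
  "drop_along e y = y - (y \<bullet> e) *\<^sub>R e"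

definition below_graph ::
  "'a::euclidean_space set \<Rightarrow> 'a \<Rightarrow> real \<Rightarrow> 'a \<Rightarrow> ('a \<Rightarrow> real) \<Rightarrow> bool" where
  "below_graph \<Omega> x r e \<gamma> \<longleftrightarrow>
     r > 0 \<and> norm e = 1 \<and> (\<exists>L. L-lipschitz_on {z. z \<bullet> e = 0} \<gamma>) \<and>
     \<Omega> \<inter> ball x r = {y \<in> ball x r. y \<bullet> e < \<gamma> (drop_along e y)}"

definition bounded_lipschitz_domain :: "'a::euclidean_space set \<Rightarrow> bool" where
  "bounded_lipschitz_domain \<Omega> \<longleftrightarrow>
     \<Omega> \<noteq> {} \<and> open \<Omega> \<and> connected \<Omega> \<and> bounded \<Omega> \<and>
     (\<forall>x\<in>frontier \<Omega>. \<exists>r e \<gamma>. below_graph \<Omega> x r e \<gamma>)"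

text \<open>
  The outward normal is \<open>(-\<nabla>\<gamma>, 1) / sqrt (1 + |\<nabla>\<gamma>|\<^sup>2)\<close> in the coordinates above, where \<open>g\<close>
  plays the role of \<open>\<nabla>\<gamma>\<close>; on a Lipschitz boundary it exists almost everywhere.
\<close>

definition outward_unit_normal :: "'a::euclidean_space set \<Rightarrow> 'a \<Rightarrow> 'a \<Rightarrow> bool" where
  "outward_unit_normal \<Omega> x \<nu> \<longleftrightarrow>
     x \<in> frontier \<Omega> \<and>
     (\<exists>r e \<gamma> g. below_graph \<Omega> x r e \<gamma> \<and> g \<bullet> e = 0 \<and>
        (\<gamma> has_derivative (\<lambda>h. g \<bullet> h)) (at (drop_along e x) within {z. z \<bullet> e = 0}) \<and>
        \<nu> = (e - g) /\<^sub>R norm (e - g))"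

definition partial :: "'a::euclidean_space \<Rightarrow> ('a \<Rightarrow> real) \<Rightarrow> 'a \<Rightarrow> real" where
  "partial i \<phi> = (\<lambda>x. frechet_derivative \<phi> (at x) i)"

primrec Ck :: "nat \<Rightarrow> ('a::euclidean_space \<Rightarrow> real) \<Rightarrow> bool" where
  "Ck 0 \<phi> \<longleftrightarrow> continuous_on UNIV \<phi>"
| "Ck (Suc k) \<phi> \<longleftrightarrow> (\<forall>x. \<phi> differentiable at x) \<and> (\<forall>i\<in>Basis. Ck k (partial i \<phi>))"

definition smooth :: "('a::euclidean_space \<Rightarrow> real) \<Rightarrow> bool" where
  "smooth \<phi> \<longleftrightarrow> (\<forall>k. Ck k \<phi>)"

definition test_function :: "'a::euclidean_space set \<Rightarrow> ('a \<Rightarrow> real) \<Rightarrow> bool" where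
  "test_function \<Omega> \<phi> \<longleftrightarrow>
     smooth \<phi> \<and> compact (closure {x. \<phi> x \<noteq> 0}) \<and> closure {x. \<phi> x \<noteq> 0} \<subseteq> \<Omega>"

text \<open>\<open>H1_with_gradient \<Omega> v p\<close>: \<open>v\<close> is in \<open>H\<^sup>1(\<Omega>)\<close> with weak partial derivatives \<open>p i\<close>, \<open>i \<in> Basis\<close>.\<close>

definition H1_with_gradient ::
  "'a::euclidean_space set \<Rightarrow> ('a \<Rightarrow> real) \<Rightarrow> ('a \<Rightarrow> 'a \<Rightarrow> real) \<Rightarrow> bool" where
  "H1_with_gradient \<Omega> v p \<longleftrightarrow>
     v \<in> square_integrable (volume_on \<Omega>) \<and>
     (\<forall>i\<in>Basis. p i \<in> square_integrable (volume_on \<Omega>) \<and>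
        (\<forall>\<phi>. test_function \<Omega> \<phi> \<longrightarrow>
           (LINT x|volume_on \<Omega>. v x * partial i \<phi> x) = - (LINT x|volume_on \<Omega>. p i x * \<phi> x)))"

definition H2_with_gradient ::
  "'a::euclidean_space set \<Rightarrow> ('a \<Rightarrow> real) \<Rightarrow> ('a \<Rightarrow> 'a \<Rightarrow> real) \<Rightarrow> bool" where
  "H2_with_gradient \<Omega> v p \<longleftrightarrow>
     H1_with_gradient \<Omega> v p \<and> (\<forall>i\<in>Basis. \<exists>q. H1_with_gradient \<Omega> (p i) q)"

text \<open>
  The trace operator is the continuous extension to \<open>H\<^sup>1(\<Omega>)\<close> of the restriction of smooth
  functions to the boundary, as a map into \<open>L\<^sup>2\<close> of the boundary; here it is given as a relation
  between \<open>v\<close> (with weak gradient \<open>p\<close>) and its trace \<open>a\<close>.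
\<close>

definition has_trace ::
  "'a::euclidean_space set \<Rightarrow> ('a \<Rightarrow> real) \<Rightarrow> ('a \<Rightarrow> 'a \<Rightarrow> real) \<Rightarrow> ('a \<Rightarrow> real) \<Rightarrow> bool" where
  "has_trace \<Omega> v p a \<longleftrightarrow>
     H1_with_gradient \<Omega> v p \<and> a \<in> square_integrable (surface_on \<Omega>) \<and>
     (\<exists>\<phi> :: nat \<Rightarrow> 'a \<Rightarrow> real.
        (\<forall>k. smooth (\<phi> k)) \<and>
        (\<lambda>k. LINT x|volume_on \<Omega>. (\<phi> k x - v x)\<^sup>2) \<longlonglongrightarrow> 0 \<and>
        (\<forall>i\<in>Basis. (\<lambda>k. LINT x|volume_on \<Omega>. (partial i (\<phi> k) x - p i x)\<^sup>2) \<longlonglongrightarrow> 0) \<and>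
        (\<lambda>k. LINT x|surface_on \<Omega>. (\<phi> k x - a x)\<^sup>2) \<longlonglongrightarrow> 0)"

text \<open>\<open>t i\<close> is the trace of the \<open>i\<close>-th partial derivative, so that \<open>b = n \<bullet> \<nabla>v\<close>.\<close>

definition has_normal_derivative ::
  "'a::euclidean_space set \<Rightarrow> ('a \<Rightarrow> 'a \<Rightarrow> real) \<Rightarrow> ('a \<Rightarrow> real) \<Rightarrow> bool" where
  "has_normal_derivative \<Omega> p b \<longleftrightarrow>
     b \<in> square_integrable (surface_on \<Omega>) \<and>
     (\<exists>t. (\<forall>i\<in>Basis. \<exists>q. has_trace \<Omega> (p i) q (t i)) \<and>
        (AE x in surface_on \<Omega>. \<exists>\<nu>. outward_unit_normal \<Omega> x \<nu> \<and>
           b x = (\<Sum>i\<in>Basis. (\<nu> \<bullet> i) * t i x)))"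

definition H2_boundary_data ::
  "'a::euclidean_space set \<Rightarrow> ('a \<Rightarrow> real) \<Rightarrow> ('a \<Rightarrow> real) \<Rightarrow> bool" where
  "H2_boundary_data \<Omega> a b \<longleftrightarrow>
     (\<exists>v p. H2_with_gradient \<Omega> v p \<and> has_trace \<Omega> v p a \<and> has_normal_derivative \<Omega> p b)"

text \<open>Kernel profiles are functions on \<open>[0,\<infinity>)\<close>; their values at negative arguments are irrelevant.\<close>

definition kernel_profile :: "real \<Rightarrow> (real \<Rightarrow> real) \<Rightarrow> bool" where
  "kernel_profile r k \<longleftrightarrow>
     (\<forall>s\<ge>0. 0 \<le> k s) \<and>
     (\<exists>k'. (\<forall>s\<ge>0. (k has_real_derivative k' s) (at s within {0..})) \<and> continuous_on {0..} k') \<and>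
     antimono_on {0..} k \<and>
     closure {s. 0 \<le> s \<and> k s \<noteq> 0} \<subseteq> {0..r\<^sup>2 / 4}"

definition tail_profile :: "(real \<Rightarrow> real) \<Rightarrow> real \<Rightarrow> real" where
  "tail_profile k s = (LBINT t:{s..}. k t)"

definition scaled_kernel :: "real \<Rightarrow> (real \<Rightarrow> real) \<Rightarrow> 'a::euclidean_space \<Rightarrow> 'a \<Rightarrow> real" where
  "scaled_kernel \<delta> k x y = 1 / \<delta> ^ DIM('a) * k ((norm (x - y))\<^sup>2 / (4 * \<delta>\<^sup>2))"

definition boundary_penalty ::
  "'a::euclidean_space set \<Rightarrow> (real \<Rightarrow> real) \<Rightarrow> real \<Rightarrow> real \<Rightarrow> ('a \<Rightarrow> real) \<Rightarrow> ('a \<Rightarrow> real) \<Rightarrow> real" where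
  "boundary_penalty \<Omega> K \<delta> \<xi> a u =
     1 / \<xi> * (LINT x|surface_on \<Omega>.
       (LINT y|volume_on \<Omega>. scaled_kernel \<delta> K x y * (a x - u y))\<^sup>2)"

definition nonlocal_functional ::
  "'a::euclidean_space set \<Rightarrow> (real \<Rightarrow> real) \<Rightarrow> (real \<Rightarrow> real) \<Rightarrow> real \<Rightarrow> real \<Rightarrow>
   ('a \<Rightarrow> real) \<Rightarrow> ('a \<Rightarrow> real) \<Rightarrow> ('a \<Rightarrow> real) \<Rightarrow> ('a \<Rightarrow> real) \<Rightarrow> real" where
  "nonlocal_functional \<Omega> K R \<delta> \<xi> f a b u =
     (LINT x|volume_on \<Omega>.
        (1 / \<delta>\<^sup>2 * (LINT y|volume_on \<Omega>. scaled_kernel \<delta> R x y * (u x - u y))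
         - 2 * (LINT y|surface_on \<Omega>. scaled_kernel \<delta> (tail_profile R) x y * b y))\<^sup>2)
     - 2 * (LINT x|volume_on \<Omega>. f x * u x)
     + boundary_penalty \<Omega> K \<delta> \<xi> a u"

end

theory Submission
  imports Defs "HOL-Complex_Analysis.Great_Picard"
begin

text \<open>
  Write \<open>M\<close> for the volume measure on \<open>\<Omega>\<close>, \<open>S\<close> for the surface measure on its boundary, \<open>k\<close> and
  \<open>k'\<close> for the kernels \<open>R\<^sub>\<delta>\<close> and \<open>K\<^sub>\<delta>\<close>, \<open>T u x = \<integral> k x y u(y) dy\<close>, \<open>T' u x = \<integral> k' x y u(y) dy\<close> and
  \<open>w x = \<integral> k x y dy\<close>.  The functional is then
  \<open>F u = \<parallel>\<delta>\<^sup>-\<^sup>2 (w u - T u) - g\<parallel>\<^sup>2 - 2 \<integral> f u dM + \<xi>\<^sup>-\<^sup>1 \<parallel>h - T' u\<parallel>\<^sup>2\<close>,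
  where the norms are those of \<open>L\<^sup>2(M)\<close> and \<open>L\<^sup>2(S)\<close>, and
  \<open>g\<close> and \<open>h\<close> are determined by \<open>b\<close> and \<open>a\<close>.  Its quadratic part is
  \<open>Q u = \<delta>\<^sup>-\<^sup>4 \<parallel>w u - T u\<parallel>\<^sup>2 + \<xi>\<^sup>-\<^sup>1 \<parallel>T' u\<parallel>\<^sup>2\<close>, and everything rests on coercivity,
  \<open>c \<parallel>u\<parallel>\<^sup>2 \<le> Q u\<close> with \<open>c > 0\<close>.  Given this, \<open>F\<close> is strongly convex, continuous and bounded below
  on \<open>L\<^sup>2\<close>: by the parallelogram identity minimising sequences are Cauchy and two minimisers
  agree almost everywhere (\<open>strongly_convex_arg_min\<close>, \<open>quadratic_functional_arg_min\<close>).

  Coercivity (\<open>kernel_op_coercive\<close>) follows from injectivity, as \<open>w\<close> is bounded below and \<open>T\<close> is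
  compact.  If it failed there would be \<open>u\<^sub>n\<close> of norm one with \<open>Q u\<^sub>n \<longrightarrow> 0\<close>.  The functions
  \<open>T u\<^sub>n\<close> are bounded and equicontinuous on the closure of \<open>\<Omega>\<close>, so by Arzela-Ascoli a
  subsequence converges uniformly to some \<open>\<phi>\<close>; as \<open>w u\<^sub>n - T u\<^sub>n \<longrightarrow> 0\<close>, the \<open>u\<^sub>n\<close> converge in
  \<open>L\<^sup>2\<close> to \<open>v = \<phi> / w\<close>.  The limit is continuous, has norm one and satisfies \<open>w v = T v\<close>
  everywhere on the closure and \<open>T' v = 0\<close> almost everywhere on the boundary.

  Such a \<open>v\<close> must vanish (\<open>nonlocal_operators_injective\<close>).  The equation \<open>w v = T v\<close> says that
  \<open>v x\<close> is a weighted mean of \<open>v\<close> near \<open>x\<close>, with weights that are positive close to \<open>x\<close>;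
  hence a maximum spreads to a neighbourhood of fixed size and \<open>v\<close> is a constant \<open>m\<close> on the
  connected set \<open>\<Omega>\<close> (\<open>kernel_op_mean_value_constant\<close>).  At a boundary point \<open>x\<close>, \<open>T' v x\<close> is \<open>m\<close>
  times the positive number \<open>\<integral> k' x y dy\<close>, so \<open>m = 0\<close> as soon as the boundary is not a null
  set for the surface measure.

  Two facts about the surface measure are therefore needed: it is finite, so that the boundary
  terms are genuine square integrals (\<open>finite_surface_measure\<close>, a packing argument),
  and it is not zero (\<open>emeasure_surface_pos\<close>, by projecting the boundary to a hyperplane).
\<close>

section \<open>Square integrable functions\<close>

lemma square_integrableD:
  assumes "u \<in> square_integrable M"
  shows "u \<in> borel_measurable M" "integrable M (\<lambda>x. (u x)\<^sup>2)"
  using assms by (auto simp: square_integrable_def)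

lemma integrable_mult_square_integrable:
  assumes u: "u \<in> square_integrable M" and v: "v \<in> square_integrable M"
  shows "integrable M (\<lambda>x. u x * v x)"
proof (rule Bochner_Integration.integrable_bound)
  show "integrable M (\<lambda>x. (u x)\<^sup>2 + (v x)\<^sup>2)"
    using u v by (auto dest: square_integrableD)
  show "(\<lambda>x. u x * v x) \<in> borel_measurable M"
    by (intro borel_measurable_times square_integrableD(1)[OF u] square_integrableD(1)[OF v])
  have "\<bar>u x * v x\<bar> \<le> (u x)\<^sup>2 + (v x)\<^sup>2" for x
  proof -
    have "\<bar>u x * v x\<bar> \<le> 2 * \<bar>u x\<bar> * \<bar>v x\<bar>" by (simp add: abs_mult)
    also have "\<dots> \<le> (u x)\<^sup>2 + (v x)\<^sup>2" using sum_squares_bound[of "\<bar>u x\<bar>" "\<bar>v x\<bar>"] by simp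
    finally show ?thesis .
  qed
  then show "AE x in M. norm (u x * v x) \<le> norm ((u x)\<^sup>2 + (v x)\<^sup>2)" by simp
qed

lemma AE_eq_0_if_integral_square_eq_0:
  assumes "u \<in> square_integrable M" "(LINT x|M. (u x)\<^sup>2) = 0"
  shows "AE x in M. u x = 0"
  using integral_nonneg_eq_0_iff_AE[OF square_integrableD(2)[OF assms(1)]] assms(2) by simp

lemma square_integrable_lincomb:
  assumes u: "u \<in> square_integrable M" and v: "v \<in> square_integrable M"
  shows "(\<lambda>x. s * u x + t * v x) \<in> square_integrable M"
proof -
  have "(\<lambda>x. (s * u x + t * v x)\<^sup>2) = (\<lambda>x. s\<^sup>2 * (u x)\<^sup>2 + 2 * s * t * (u x * v x) + t\<^sup>2 * (v x)\<^sup>2)"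
    by (simp add: power2_eq_square algebra_simps)
  moreover have "integrable M (\<lambda>x. s\<^sup>2 * (u x)\<^sup>2 + 2 * s * t * (u x * v x) + t\<^sup>2 * (v x)\<^sup>2)"
    using square_integrableD(2)[OF u] square_integrableD(2)[OF v]
      integrable_mult_square_integrable[OF u v] by simp
  ultimately show ?thesis
    using u v by (auto simp: square_integrable_def)
qed

lemma square_integrable_scale: "u \<in> square_integrable M \<Longrightarrow> (\<lambda>x. s * u x) \<in> square_integrable M"
  using square_integrable_lincomb[of u M u s 0] by simp

lemma square_integrable_add:
  "u \<in> square_integrable M \<Longrightarrow> v \<in> square_integrable M \<Longrightarrow> (\<lambda>x. u x + v x) \<in> square_integrable M"
  using square_integrable_lincomb[of u M v 1 1] by simp

lemma square_integrable_diff: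
  "u \<in> square_integrable M \<Longrightarrow> v \<in> square_integrable M \<Longrightarrow> (\<lambda>x. u x - v x) \<in> square_integrable M"
  using square_integrable_lincomb[of u M v 1 "-1"] by simp

lemma (in finite_measure) square_integrable_bounded:
  assumes "u \<in> borel_measurable M" "\<And>x. x \<in> space M \<Longrightarrow> \<bar>u x\<bar> \<le> B"
  shows "u \<in> square_integrable M"
  unfolding square_integrable_def
proof safe
  show "integrable M (\<lambda>x. (u x)\<^sup>2)"
  proof (rule integrable_const_bound[where B = "B\<^sup>2"])
    have "(u x)\<^sup>2 \<le> B\<^sup>2" if "x \<in> space M" for x
      using power_mono[OF assms(2)[OF that] abs_ge_zero, of 2] by simp
    then show "AE x in M. norm ((u x)\<^sup>2) \<le> B\<^sup>2" by (intro AE_I2) simp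
  qed (use assms in auto)
qed (fact assms)

lemma (in finite_measure) square_integrable_mult_bounded:
  assumes "u \<in> square_integrable M" "w \<in> borel_measurable M" "\<And>x. x \<in> space M \<Longrightarrow> \<bar>w x\<bar> \<le> B"
  shows "(\<lambda>x. w x * u x) \<in> square_integrable M"
  unfolding square_integrable_def
proof safe
  show m: "(\<lambda>x. w x * u x) \<in> borel_measurable M"
    using assms by (auto dest: square_integrableD)
  show "integrable M (\<lambda>x. (w x * u x)\<^sup>2)"
  proof (rule Bochner_Integration.integrable_bound)
    show "integrable M (\<lambda>x. B\<^sup>2 * (u x)\<^sup>2)"
      using square_integrableD(2)[OF assms(1)] by simp
    have "(w x)\<^sup>2 * (u x)\<^sup>2 \<le> B\<^sup>2 * (u x)\<^sup>2" if "x \<in> space M" for x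
      using power_mono[OF assms(3)[OF that] abs_ge_zero, of 2] by (intro mult_right_mono) auto
    then show "AE x in M. norm ((w x * u x)\<^sup>2) \<le> norm (B\<^sup>2 * (u x)\<^sup>2)"
      by (intro AE_I2) (simp add: power_mult_distrib)
  qed (use m in simp)
qed

lemma integral_square_lincomb:
  assumes u: "u \<in> square_integrable M" and v: "v \<in> square_integrable M"
  shows "(LINT x|M. (u x + t * v x)\<^sup>2) =
    (LINT x|M. (u x)\<^sup>2) + 2 * t * (LINT x|M. u x * v x) + t\<^sup>2 * (LINT x|M. (v x)\<^sup>2)"
proof -
  have "(\<lambda>x. (u x + t * v x)\<^sup>2) = (\<lambda>x. (u x)\<^sup>2 + 2 * t * (u x * v x) + t\<^sup>2 * (v x)\<^sup>2)"
    by (simp add: power2_eq_square algebra_simps)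
  then show ?thesis
    using square_integrableD(2)[OF u] square_integrableD(2)[OF v]
      integrable_mult_square_integrable[OF u v] by simp
qed

text \<open>
  The usual discriminant argument: \<open>\<integral> (u + t v)\<^sup>2\<close> is a non-negative quadratic polynomial in \<open>t\<close>.
\<close>

lemma Cauchy_Schwarz_integral:
  assumes u: "u \<in> square_integrable M" and v: "v \<in> square_integrable M"
  shows "(LINT x|M. u x * v x)\<^sup>2 \<le> (LINT x|M. (u x)\<^sup>2) * (LINT x|M. (v x)\<^sup>2)"
proof -
  define A B C where "A = (LINT x|M. (u x)\<^sup>2)" "B = (LINT x|M. u x * v x)" "C = (LINT x|M. (v x)\<^sup>2)"
  have nonneg: "0 \<le> A + 2 * t * B + t\<^sup>2 * C" for t
    using integral_square_lincomb[OF u v, of t] unfolding A_B_C_def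
    by (metis (mono_tags, lifting) Bochner_Integration.integral_nonneg zero_le_power2)
  have "C \<ge> 0" unfolding A_B_C_def by simp
  show ?thesis
    unfolding A_B_C_def[symmetric]
  proof (cases "C = 0")
    case True
    (* a non-negative affine function of t is constant *)
    have "B = 0"
    proof (rule ccontr)
      assume "B \<noteq> 0"
      then show False using nonneg[of "- (A + 1) / (2 * B)"] True by (simp add: field_simps)
    qed
    then show "B\<^sup>2 \<le> A * C" using True by simp
  next
    case False
    (* t = - B / C minimises the polynomial *)
    have "A + 2 * (- B / C) * B + (- B / C)\<^sup>2 * C = A - B\<^sup>2 / C"
      using False by (simp add: power2_eq_square field_simps)
    then have "0 \<le> A - B\<^sup>2 / C" using nonneg[of "- B / C"] by simp
    then show "B\<^sup>2 \<le> A * C" using False \<open>C \<ge> 0\<close> by (simp add: field_simps)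
  qed
qed

lemma (in finite_measure) square_integrable_const: "(\<lambda>x. c) \<in> square_integrable M"
  by (rule square_integrable_bounded[where B = "\<bar>c\<bar>"]) auto

lemma square_integrable_abs: "u \<in> square_integrable M \<Longrightarrow> (\<lambda>x. \<bar>u x\<bar>) \<in> square_integrable M"
  by (auto simp: square_integrable_def)

lemma (in finite_measure) integrable_square_integrable:
  "u \<in> square_integrable M \<Longrightarrow> integrable M u"
  using integrable_mult_square_integrable[OF _ square_integrable_const[of 1]] by simp

lemma (in finite_measure) integral_abs_power2_le:
  assumes "u \<in> square_integrable M"
  shows "(LINT x|M. \<bar>u x\<bar>)\<^sup>2 \<le> measure M (space M) * (LINT x|M. (u x)\<^sup>2)"
  using Cauchy_Schwarz_integral[OF square_integrable_abs[OF assms] square_integrable_const[of 1]]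
  by (simp add: mult.commute)

text \<open>
  A substitute for the triangle inequality of the \<open>L\<^sup>2\<close> norm that avoids square roots.
\<close>

lemma integral_square_add_le:
  assumes u: "u \<in> square_integrable M" and v: "v \<in> square_integrable M"
  shows "(LINT x|M. (u x + v x)\<^sup>2) \<le> 2 * (LINT x|M. (u x)\<^sup>2) + 2 * (LINT x|M. (v x)\<^sup>2)"
proof -
  have "(LINT x|M. (u x + v x)\<^sup>2) \<le> (LINT x|M. 2 * (u x)\<^sup>2 + 2 * (v x)\<^sup>2)"
  proof (rule integral_mono)
    fix x show "(u x + v x)\<^sup>2 \<le> 2 * (u x)\<^sup>2 + 2 * (v x)\<^sup>2"
      using zero_le_power2[of "u x - v x"] unfolding power2_eq_square by (simp add: algebra_simps)
  qed (use square_integrableD(2)[OF square_integrable_add[OF u v]]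
      square_integrableD(2)[OF u] square_integrableD(2)[OF v] in auto)
  also have "\<dots> = 2 * (LINT x|M. (u x)\<^sup>2) + 2 * (LINT x|M. (v x)\<^sup>2)"
    using square_integrableD(2)[OF u] square_integrableD(2)[OF v] by simp
  finally show ?thesis .
qed

lemma tendsto_integral_mult_L2:
  assumes f: "f \<in> square_integrable M" and p: "\<And>n. p n \<in> square_integrable M" and q: "q \<in> square_integrable M"
    and lim: "(\<lambda>n. LINT x|M. (p n x - q x)\<^sup>2) \<longlonglongrightarrow> 0"
  shows "(\<lambda>n. LINT x|M. f x * p n x) \<longlonglongrightarrow> (LINT x|M. f x * q x)"
proof -
  have eq: "(LINT x|M. f x * (p n x - q x)) = (LINT x|M. f x * p n x) - (LINT x|M. f x * q x)" for n
    using integrable_mult_square_integrable[OF f p[of n]] integrable_mult_square_integrable[OF f q]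
    by (simp add: right_diff_distrib)
  have "(\<lambda>n. (LINT x|M. (f x)\<^sup>2) * (LINT x|M. (p n x - q x)\<^sup>2)) \<longlonglongrightarrow> 0"
    using tendsto_mult_left[OF lim] by simp
  then have "(\<lambda>n. (LINT x|M. f x * (p n x - q x))\<^sup>2) \<longlonglongrightarrow> 0"
    by (rule tendsto_sandwich[OF _ _ tendsto_const, rotated 2])
      (auto intro!: always_eventually Cauchy_Schwarz_integral f square_integrable_diff p q)
  then have "(\<lambda>n. sqrt ((LINT x|M. f x * (p n x - q x))\<^sup>2)) \<longlonglongrightarrow> sqrt 0"
    by (rule tendsto_real_sqrt)
  then have "(\<lambda>n. (LINT x|M. f x * (p n x - q x))) \<longlonglongrightarrow> 0"
    by (simp add: tendsto_rabs_zero_iff)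
  then show ?thesis unfolding eq by (simp add: LIM_zero_iff)
qed

text \<open>
  The norm is continuous: expand \<open>(p n - q)\<^sup>2\<close> and use that the pairing with \<open>q\<close> converges.
\<close>

lemma tendsto_integral_square_L2:
  assumes p: "\<And>n. p n \<in> square_integrable M" and q: "q \<in> square_integrable M"
    and lim: "(\<lambda>n. LINT x|M. (p n x - q x)\<^sup>2) \<longlonglongrightarrow> 0"
  shows "(\<lambda>n. LINT x|M. (p n x)\<^sup>2) \<longlonglongrightarrow> (LINT x|M. (q x)\<^sup>2)"
proof -
  have eq: "(LINT x|M. (p n x)\<^sup>2) =
      (LINT x|M. (p n x - q x)\<^sup>2) + 2 * (LINT x|M. q x * p n x) - (LINT x|M. (q x)\<^sup>2)" for n
    using integral_square_lincomb[OF p[of n] q, of "-1"] by (simp add: mult.commute)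
  have "(\<lambda>n. (LINT x|M. (p n x - q x)\<^sup>2) + 2 * (LINT x|M. q x * p n x) - (LINT x|M. (q x)\<^sup>2))
      \<longlonglongrightarrow> 0 + 2 * (LINT x|M. q x * q x) - (LINT x|M. (q x)\<^sup>2)"
    by (intro tendsto_intros lim tendsto_integral_mult_L2 p q)
  then show ?thesis unfolding eq[symmetric] by (simp add: power2_eq_square)
qed

text \<open>
  Riesz-Fischer.  On a finite measure space the \<open>L\<^sup>1\<close> norm is controlled by the \<open>L\<^sup>2\<close> norm, so along
  a subsequence with geometrically decreasing increments the sum of the absolute increments
  is integrable; the subsequence therefore converges almost everywhere.  Fatou's lemma turns
  the Cauchy estimate into an estimate of the distance to this limit.
\<close>

lemma (in finite_measure) L2_complete:
  assumes u: "\<And>n. u n \<in> square_integrable M"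
    and Cauchy: "\<And>e. e > 0 \<Longrightarrow> \<exists>N::nat. \<forall>m\<ge>N. \<forall>n\<ge>N. (LINT x|M. (u m x - u n x)\<^sup>2) < e"
  obtains v where "v \<in> square_integrable M" "(\<lambda>n. LINT x|M. (u n x - v x)\<^sup>2) \<longlonglongrightarrow> 0"
proof -
  have meas [measurable]: "u n \<in> borel_measurable M" for n using square_integrableD(1)[OF u] .
  have nn: "(\<integral>\<^sup>+x. ennreal ((u m x - u n x)\<^sup>2) \<partial>M) = ennreal (LINT x|M. (u m x - u n x)\<^sup>2)" for m n
    by (rule nn_integral_eq_integral)
      (auto intro: square_integrableD(2)[OF square_integrable_diff[OF u u]])
  have "\<exists>N. \<forall>m\<ge>N. \<forall>n\<ge>N. (LINT x|M. (u m x - u n x)\<^sup>2) < (1/4)^k" for k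
    by (rule Cauchy) simp
  then obtain N where N: "\<And>k m n. m \<ge> N k \<Longrightarrow> n \<ge> N k \<Longrightarrow> (LINT x|M. (u m x - u n x)\<^sup>2) < (1/4)^k"
    by metis
  (* the sum gives N k \<le> s k, the summand k makes s strictly increasing *)
  define s where "s k = (\<Sum>j\<le>k. N j) + k" for k
  have s_ge: "s k \<ge> N k" for k
    unfolding s_def using member_le_sum[of k "{..k}" N] by (simp add: trans_le_add1)
  have s_mono: "s k < s (Suc k)" for k by (simp add: s_def)
  then have smono: "strict_mono s" by (simp add: strict_mono_Suc_iff)
  define d where "d k x = u (s (Suc k)) x - u (s k) x" for k x
  have d: "d k \<in> square_integrable M" for k
    unfolding d_def by (intro square_integrable_diff u)
  define V where "V = measure M (space M)"
  have d_small: "(LINT x|M. \<bar>d k x\<bar>) \<le> sqrt V * (1/2)^k" for k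
  proof -
    have "(LINT x|M. \<bar>d k x\<bar>)\<^sup>2 \<le> V * (LINT x|M. (d k x)\<^sup>2)"
      unfolding V_def by (rule integral_abs_power2_le[OF d])
    also have "\<dots> \<le> V * (1/4)^k"
      unfolding d_def V_def
      by (rule mult_left_mono[OF less_imp_le[OF N]]) (use s_ge[of k] s_mono[of k] in auto)
    also have "\<dots> = (sqrt V * (1/2)^k)\<^sup>2"
    proof -
      have "((1/2 :: real)^k)\<^sup>2 = (1/4)^k" by (simp add: power2_eq_square flip: power_mult_distrib)
      then show ?thesis by (simp add: power_mult_distrib V_def)
    qed
    finally show ?thesis
      by (rule power2_le_imp_le) (simp add: V_def)
  qed
  have "(\<integral>\<^sup>+x. (\<Sum>k. ennreal \<bar>d k x\<bar>) \<partial>M) = (\<Sum>k. \<integral>\<^sup>+x. ennreal \<bar>d k x\<bar> \<partial>M)"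
    by (rule nn_integral_suminf) (use square_integrableD(1)[OF d] in measurable)
  also have "\<dots> = (\<Sum>k. ennreal (LINT x|M. \<bar>d k x\<bar>))"
    by (intro suminf_cong nn_integral_eq_integral)
       (auto intro!: integrable_abs integrable_square_integrable[OF d])
  also have "\<dots> \<le> (\<Sum>k. ennreal (sqrt V * (1/2)^k))"
    by (intro suminf_le ennreal_leI d_small) auto
  also have "\<dots> = ennreal (\<Sum>k. sqrt V * (1/2)^k)"
    by (rule suminf_ennreal2) (auto simp: V_def intro!: summable_mult summable_geometric)
  finally have "(\<integral>\<^sup>+x. (\<Sum>k. ennreal \<bar>d k x\<bar>) \<partial>M) \<noteq> \<infinity>"
    by (auto simp: top_unique)
  then have AE_fin: "AE x in M. (\<Sum>k. ennreal \<bar>d k x\<bar>) \<noteq> \<infinity>"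
    by (intro nn_integral_PInf_AE) (use square_integrableD(1)[OF d] in measurable)
  have conv: "convergent (\<lambda>k. u (s k) x)" if "(\<Sum>k. ennreal \<bar>d k x\<bar>) \<noteq> \<infinity>" for x
  proof -
    have "summable (\<lambda>k. \<bar>d k x\<bar>)"
      using that by (intro summable_suminf_not_top) auto
    then have "summable (\<lambda>k. d k x)" by (rule summable_rabs_cancel)
    then have "convergent (\<lambda>n. \<Sum>k<n. d k x)" by (simp add: summable_iff_convergent)
    then have "convergent (\<lambda>n. (\<Sum>k<n. d k x) + u (s 0) x)"
      by (intro convergent_add convergent_const)
    moreover have "(\<Sum>k<n. d k x) + u (s 0) x = u (s n) x" for n
      unfolding d_def using sum_lessThan_telescope[of "\<lambda>k. u (s k) x" n] by simp
    ultimately show ?thesis by simp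
  qed
  define v where "v x = lim (\<lambda>k. u (s k) x)" for x
  have v_meas [measurable]: "v \<in> borel_measurable M"
    unfolding v_def by measurable
  have AE_lim: "AE x in M. (\<lambda>k. u (s k) x) \<longlonglongrightarrow> v x"
    using AE_fin by eventually_elim (use conv in \<open>simp add: v_def convergent_LIMSEQ_iff\<close>)
  have tail: "(\<integral>\<^sup>+x. ennreal ((u n x - v x)\<^sup>2) \<partial>M) \<le> ennreal e"
    if e: "e > 0" and n: "n \<ge> N0" and N0: "\<And>m n. m \<ge> N0 \<Longrightarrow> n \<ge> N0 \<Longrightarrow> (LINT x|M. (u m x - u n x)\<^sup>2) < e"
    for e n N0
  proof -
    have "(\<integral>\<^sup>+x. ennreal ((u n x - v x)\<^sup>2) \<partial>M)
        = (\<integral>\<^sup>+x. liminf (\<lambda>k. ennreal ((u n x - u (s k) x)\<^sup>2)) \<partial>M)"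
    proof (rule nn_integral_cong_AE)
      show "AE x in M. ennreal ((u n x - v x)\<^sup>2) = liminf (\<lambda>k. ennreal ((u n x - u (s k) x)\<^sup>2))"
        using AE_lim
      proof eventually_elim
        case (elim x)
        have L: "(\<lambda>k. ennreal ((u n x - u (s k) x)\<^sup>2)) \<longlonglongrightarrow> ennreal ((u n x - v x)\<^sup>2)"
          by (intro tendsto_intros tendsto_ennrealI elim)
        show ?case by (rule lim_imp_Liminf[OF _ L, symmetric]) simp
      qed
    qed
    also have "\<dots> \<le> liminf (\<lambda>k. \<integral>\<^sup>+x. ennreal ((u n x - u (s k) x)\<^sup>2) \<partial>M)"
      by (rule nn_integral_liminf) measurable
    also have "\<dots> \<le> limsup (\<lambda>k. \<integral>\<^sup>+x. ennreal ((u n x - u (s k) x)\<^sup>2) \<partial>M)"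
      by (rule Liminf_le_Limsup) simp
    also have "\<dots> \<le> ennreal e"
    proof (rule Limsup_bounded)
      show "\<forall>\<^sub>F k in sequentially. (\<integral>\<^sup>+x. ennreal ((u n x - u (s k) x)\<^sup>2) \<partial>M) \<le> ennreal e"
        using eventually_ge_at_top[of N0]
      proof eventually_elim
        case (elim k)
        then have "s k \<ge> N0" using seq_suble[OF smono, of k] by simp
        then show ?case unfolding nn using N0[of n "s k"] n by (intro ennreal_leI) simp
      qed
    qed
    finally show ?thesis .
  qed
  have diffSI: "(\<lambda>x. u n x - v x) \<in> square_integrable M"
    and tail': "(LINT x|M. (u n x - v x)\<^sup>2) \<le> e"
    if e: "e > 0" and n: "n \<ge> N0" and N0: "\<And>m n. m \<ge> N0 \<Longrightarrow> n \<ge> N0 \<Longrightarrow> (LINT x|M. (u m x - u n x)\<^sup>2) < e"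
    for e n N0
  proof -
    note le = tail[OF that]
    show si: "(\<lambda>x. u n x - v x) \<in> square_integrable M"
      unfolding square_integrable_def using le
      by (auto intro!: integrableI_bounded simp: top_unique less_top[symmetric])
    have "ennreal (LINT x|M. (u n x - v x)\<^sup>2) \<le> ennreal e"
      using le nn_integral_eq_integral[OF square_integrableD(2)[OF si]] by simp
    then show "(LINT x|M. (u n x - v x)\<^sup>2) \<le> e" using e by simp
  qed
  obtain N1 where N1: "\<forall>m\<ge>N1. \<forall>n\<ge>N1. (LINT x|M. (u m x - u n x)\<^sup>2) < 1" using Cauchy[of 1] by auto
  have "(\<lambda>x. u N1 x - (u N1 x - v x)) \<in> square_integrable M"
    by (intro square_integrable_diff[OF u] diffSI[of 1 N1 N1]) (use N1 in auto)
  then have v: "v \<in> square_integrable M" by simp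
  have "(\<lambda>n. LINT x|M. (u n x - v x)\<^sup>2) \<longlonglongrightarrow> 0"
  proof (rule LIMSEQ_I)
    fix r :: real assume r: "r > 0"
    obtain N2 where N2: "\<forall>m\<ge>N2. \<forall>n\<ge>N2. (LINT x|M. (u m x - u n x)\<^sup>2) < r / 2"
      using Cauchy[of "r/2"] r by auto
    show "\<exists>no. \<forall>n\<ge>no. norm ((LINT x|M. (u n x - v x)\<^sup>2) - 0) < r"
    proof (intro exI allI impI)
      fix n assume "n \<ge> N2"
      then have "(LINT x|M. (u n x - v x)\<^sup>2) \<le> r / 2"
        by (intro tail'[of "r/2" N2 n]) (use N2 r in auto)
      then show "norm ((LINT x|M. (u n x - v x)\<^sup>2) - 0) < r" using r by simp
    qed
  qed
  with v show thesis by (rule that)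
qed

section \<open>Minimisers of strongly convex functionals\<close>

text \<open>
  Strong convexity at the midpoint bounds the squared distance of two functions by the amount
  by which their values exceed the infimum.  Hence every minimising sequence is Cauchy, and
  minimisers are unique up to null sets.
\<close>

lemma (in finite_measure) strongly_convex_arg_min:
  fixes \<Phi> :: "('a \<Rightarrow> real) \<Rightarrow> real"
  assumes c: "c > 0"
    and below: "\<And>u. u \<in> square_integrable M \<Longrightarrow> L \<le> \<Phi> u"
    and convex: "\<And>u w. u \<in> square_integrable M \<Longrightarrow> w \<in> square_integrable M \<Longrightarrow>
        2 * \<Phi> (\<lambda>x. (u x + w x) / 2) + c * (LINT x|M. (u x - w x)\<^sup>2) \<le> \<Phi> u + \<Phi> w"
    and cont: "\<And>u v. (\<And>n. u n \<in> square_integrable M) \<Longrightarrow> v \<in> square_integrable M \<Longrightarrow>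
        (\<lambda>n. LINT x|M. (u n x - v x)\<^sup>2) \<longlonglongrightarrow> 0 \<Longrightarrow> (\<lambda>n. \<Phi> (u n)) \<longlonglongrightarrow> \<Phi> v"
  shows "\<exists>u. is_arg_min \<Phi> (\<lambda>v. v \<in> square_integrable M) u \<and>
    (\<forall>w. is_arg_min \<Phi> (\<lambda>v. v \<in> square_integrable M) w \<longrightarrow> (AE x in M. w x = u x))"
proof -
  define I where "I = Inf (\<Phi> ` square_integrable M)"
  have ne: "\<Phi> ` square_integrable M \<noteq> {}" using square_integrable_const by auto
  have bdd: "bdd_below (\<Phi> ` square_integrable M)" using below by (auto intro!: bdd_belowI)
  have I_le: "I \<le> \<Phi> u" if "u \<in> square_integrable M" for u
    unfolding I_def using bdd that by (auto intro: cInf_lower)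
  have mid: "(\<lambda>x. (u x + w x) / 2) \<in> square_integrable M"
    if "u \<in> square_integrable M" "w \<in> square_integrable M" for u w
    using square_integrable_lincomb[OF that, of "1/2" "1/2"] by (simp add: add_divide_distrib)
  have gap: "c * (LINT x|M. (u x - w x)\<^sup>2) \<le> (\<Phi> u - I) + (\<Phi> w - I)"
    if "u \<in> square_integrable M" "w \<in> square_integrable M" for u w
    using convex[OF that] I_le[OF mid[OF that]] by simp
  have "\<exists>u\<in>square_integrable M. \<Phi> u < I + 1 / (real n + 1)" for n
    using cInf_lessD[OF ne, of "I + 1 / (real n + 1)"] unfolding I_def by auto
  then obtain u where u: "\<And>n. u n \<in> square_integrable M" and u_lt: "\<And>n. \<Phi> (u n) < I + 1 / (real n + 1)"
    by metis
  have "\<exists>N::nat. \<forall>m\<ge>N. \<forall>n\<ge>N. (LINT x|M. (u m x - u n x)\<^sup>2) < e" if e: "e > 0" for e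
  proof -
    obtain N where N: "1 / (real N + 1) < c * e / 2"
      using reals_Archimedean[of "c * e / 2"] c e by (auto simp: inverse_eq_divide add.commute)
    have small: "\<Phi> (u n) - I < c * e / 2" if "n \<ge> N" for n
    proof -
      have "1 / (real n + 1) \<le> 1 / (real N + 1)" using that by (intro divide_left_mono) auto
      then show ?thesis using u_lt[of n] N by simp
    qed
    have "(LINT x|M. (u m x - u n x)\<^sup>2) < e" if "m \<ge> N" "n \<ge> N" for m n
    proof -
      have "c * (LINT x|M. (u m x - u n x)\<^sup>2) < c * e"
        using gap[OF u[of m] u[of n]] small[OF that(1)] small[OF that(2)] by simp
      then show ?thesis using c by simp
    qed
    then show ?thesis by blast
  qed
  then obtain v where v: "v \<in> square_integrable M" and lim: "(\<lambda>n. LINT x|M. (u n x - v x)\<^sup>2) \<longlonglongrightarrow> 0"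
    using L2_complete[of u] u by blast
  have "(\<lambda>n. I + 1 / (real n + 1)) \<longlonglongrightarrow> I + 0"
    by (intro tendsto_add tendsto_const) (use LIMSEQ_inverse_real_of_nat in \<open>simp add: inverse_eq_divide add.commute\<close>)
  then have "\<Phi> v \<le> I + 0"
    by (rule LIMSEQ_le[OF cont[OF u v lim]]) (use less_imp_le[OF u_lt] in blast)
  then have "\<Phi> v \<le> I" by simp
  then have v_min: "\<Phi> v \<le> \<Phi> w" if "w \<in> square_integrable M" for w using I_le[OF that] by simp
  then have vI: "\<Phi> v = I" using \<open>\<Phi> v \<le> I\<close> I_le[OF v] by simp
  show ?thesis
  proof (intro exI conjI allI impI)
    show "is_arg_min \<Phi> (\<lambda>v. v \<in> square_integrable M) v"
      unfolding is_arg_min_def using v v_min by (auto simp: not_less)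
    fix w assume w: "is_arg_min \<Phi> (\<lambda>v. v \<in> square_integrable M) w"
    then have wS: "w \<in> square_integrable M" and "\<Phi> w \<le> \<Phi> v"
      using v by (auto simp: is_arg_min_def not_less)
    then have "c * (LINT x|M. (w x - v x)\<^sup>2) \<le> 0" using gap[OF wS v] vI by simp
    then have "(LINT x|M. (w x - v x)\<^sup>2) = 0" using c
      by (meson Bochner_Integration.integral_nonneg dual_order.antisym mult_le_0_iff not_less zero_le_power2)
    then have "AE x in M. w x - v x = 0"
      by (rule AE_eq_0_if_integral_square_eq_0[OF square_integrable_diff[OF wS v]])
    then show "AE x in M. w x = v x" by simp
  qed
qed

lemma integral_square_parallelogram:
  assumes p: "p \<in> square_integrable M" and q: "q \<in> square_integrable M"
  shows "2 * (LINT x|M. ((p x + q x) / 2)\<^sup>2) + 1/2 * (LINT x|M. (p x - q x)\<^sup>2)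
    = (LINT x|M. (p x)\<^sup>2) + (LINT x|M. (q x)\<^sup>2)"
proof -
  have "(LINT x|M. ((p x + q x) / 2)\<^sup>2) = (LINT x|M. (p x + q x)\<^sup>2) / 4"
    by (simp add: power_divide)
  moreover have "2 * X + 1/2 * Y = a + d"
    if "X = Z / 4" "Z = a + 2 * b + d" "Y = a - 2 * b + d" for X Y Z a b d :: real
    using that by (simp add: field_simps)
  ultimately show ?thesis
    using integral_square_lincomb[OF p q, of 1] integral_square_lincomb[OF p q, of "-1"] by simp
qed

text \<open>
  The parallelogram identity in both \<open>L\<^sup>2\<close> spaces shows that the defect of convexity of \<open>\<Phi>\<close> at a
  midpoint is half the quadratic form \<open>\<parallel>A (u - w)\<parallel>\<^sup>2 + \<kappa> \<parallel>C (u - w)\<parallel>\<^sup>2\<close>, so coercivity of this form is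
  strong convexity of \<open>\<Phi>\<close>.
\<close>

theorem (in finite_measure) quadratic_functional_arg_min:
  fixes A :: "('a \<Rightarrow> real) \<Rightarrow> 'a \<Rightarrow> real" and C :: "('a \<Rightarrow> real) \<Rightarrow> 'b \<Rightarrow> real"
  assumes A: "\<And>u. u \<in> square_integrable M \<Longrightarrow> A u \<in> square_integrable M"
    and C: "\<And>u. u \<in> square_integrable M \<Longrightarrow> C u \<in> square_integrable S"
    and A_lin: "\<And>u v s t x. u \<in> square_integrable M \<Longrightarrow> v \<in> square_integrable M \<Longrightarrow> x \<in> space M \<Longrightarrow>
      A (\<lambda>x. s * u x + t * v x) x = s * A u x + t * A v x"
    and C_lin: "\<And>u v s t x. u \<in> square_integrable M \<Longrightarrow> v \<in> square_integrable M \<Longrightarrow> x \<in> space S \<Longrightarrow>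
      C (\<lambda>x. s * u x + t * v x) x = s * C u x + t * C v x"
    and A_bd: "\<And>u. u \<in> square_integrable M \<Longrightarrow> (LINT x|M. (A u x)\<^sup>2) \<le> BA * (LINT x|M. (u x)\<^sup>2)"
    and C_bd: "\<And>u. u \<in> square_integrable M \<Longrightarrow> (LINT x|S. (C u x)\<^sup>2) \<le> BC * (LINT x|M. (u x)\<^sup>2)"
    and c: "c > 0" and \<kappa>: "\<kappa> \<ge> 0"
    and coercive: "\<And>u. u \<in> square_integrable M \<Longrightarrow>
      c * (LINT x|M. (u x)\<^sup>2) \<le> (LINT x|M. (A u x)\<^sup>2) + \<kappa> * (LINT x|S. (C u x)\<^sup>2)"
    and f: "f \<in> square_integrable M" and g: "g \<in> square_integrable M" and h: "h \<in> square_integrable S"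
  defines "\<Phi> \<equiv> \<lambda>u. (LINT x|M. (A u x - g x)\<^sup>2) - 2 * (LINT x|M. f x * u x)
      + \<kappa> * (LINT x|S. (h x - C u x)\<^sup>2)"
  shows "\<exists>u. is_arg_min \<Phi> (\<lambda>v. v \<in> square_integrable M) u \<and>
    (\<forall>w. is_arg_min \<Phi> (\<lambda>v. v \<in> square_integrable M) w \<longrightarrow> (AE x in M. w x = u x))"
proof (rule strongly_convex_arg_min)
  show "c / 2 > 0" using c by simp
  define P where "P u x = A u x - g x" for u x
  define Q where "Q u x = h x - C u x" for u x
  have P: "P u \<in> square_integrable M" and Q: "Q u \<in> square_integrable S"
    if "u \<in> square_integrable M" for u
    unfolding P_def Q_def using that by (auto intro: square_integrable_diff A C g h)
  have \<Phi>: "\<Phi> u = (LINT x|M. (P u x)\<^sup>2) - 2 * (LINT x|M. f x * u x) + \<kappa> * (LINT x|S. (Q u x)\<^sup>2)" for u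
    by (simp add: \<Phi>_def P_def Q_def)
  have A_diff: "A (\<lambda>x. u x - w x) x = A u x - A w x"
    if "u \<in> square_integrable M" "w \<in> square_integrable M" "x \<in> space M" for u w x
    using A_lin[OF that, of 1 "-1"] by simp
  have C_diff: "C (\<lambda>x. u x - w x) x = C u x - C w x"
    if "u \<in> square_integrable M" "w \<in> square_integrable M" "x \<in> space S" for u w x
    using C_lin[OF that, of 1 "-1"] by simp
  have P_diff: "(LINT x|M. (P u x - P w x)\<^sup>2) = (LINT x|M. (A (\<lambda>x. u x - w x) x)\<^sup>2)"
    and Q_diff: "(LINT x|S. (Q u x - Q w x)\<^sup>2) = (LINT x|S. (C (\<lambda>x. u x - w x) x)\<^sup>2)"
    if "u \<in> square_integrable M" "w \<in> square_integrable M" for u w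
    using that
    by (auto intro!: Bochner_Integration.integral_cong simp: A_diff C_diff P_def Q_def power2_commute)

  let ?F = "LINT x|M. (f x)\<^sup>2"
  let ?G = "LINT x|M. (g x)\<^sup>2"
  let ?H = "LINT x|S. (h x)\<^sup>2"
  show "- (2 / c * ?F + ?G + \<kappa> * ?H) \<le> \<Phi> u" if u: "u \<in> square_integrable M" for u
  proof -
    let ?U = "LINT x|M. (u x)\<^sup>2"
    have "(LINT x|M. (A u x)\<^sup>2) \<le> 2 * (LINT x|M. (P u x)\<^sup>2) + 2 * ?G"
      using integral_square_add_le[OF P[OF u] g] by (simp add: P_def)
    moreover have "\<kappa> * (LINT x|S. (C u x)\<^sup>2) \<le> \<kappa> * (2 * (LINT x|S. (Q u x)\<^sup>2) + 2 * ?H)"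
      using integral_square_add_le[OF Q[OF u] square_integrable_scale[OF h, of "-1"]] \<kappa>
      by (intro mult_left_mono) (simp_all add: Q_def)
    ultimately have 1: "c / 2 * ?U \<le> (LINT x|M. (P u x)\<^sup>2) + ?G + \<kappa> * (LINT x|S. (Q u x)\<^sup>2) + \<kappa> * ?H"
      using coercive[OF u] by (simp add: algebra_simps)
    (* Young's inequality 2 f u \<le> (2/c) f^2 + (c/2) u^2, integrated; the last term is what coercivity can absorb *)
    have "0 \<le> (LINT x|M. (f x + (- c / 2) * u x)\<^sup>2)" by simp
    then have "0 \<le> ?F + - c * (LINT x|M. f x * u x) + (c / 2)\<^sup>2 * ?U"
      unfolding integral_square_lincomb[OF f u] by simp
    then have "0 \<le> 2 / c * (?F + - c * (LINT x|M. f x * u x) + (c / 2)\<^sup>2 * ?U)"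
      using c by simp
    also have "\<dots> = 2 / c * ?F - 2 * (LINT x|M. f x * u x) + c / 2 * ?U"
      using c by (simp add: field_simps power2_eq_square)
    finally show ?thesis using 1 unfolding \<Phi> by simp
  qed

  show "2 * \<Phi> (\<lambda>x. (u x + w x) / 2) + c / 2 * (LINT x|M. (u x - w x)\<^sup>2) \<le> \<Phi> u + \<Phi> w"
    if u: "u \<in> square_integrable M" and w: "w \<in> square_integrable M" for u w
  proof -
    have midA: "A (\<lambda>x. (u x + w x) / 2) x = (A u x + A w x) / 2" if "x \<in> space M" for x
      using A_lin[OF u w that, of "1/2" "1/2"] by (simp add: add_divide_distrib)
    have midC: "C (\<lambda>x. (u x + w x) / 2) x = (C u x + C w x) / 2" if "x \<in> space S" for x
      using C_lin[OF u w that, of "1/2" "1/2"] by (simp add: add_divide_distrib)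
    have mP: "(LINT x|M. (P (\<lambda>x. (u x + w x) / 2) x)\<^sup>2) = (LINT x|M. ((P u x + P w x) / 2)\<^sup>2)"
      by (intro Bochner_Integration.integral_cong refl arg_cong[where f = "\<lambda>z. z\<^sup>2"])
        (simp add: P_def midA field_simps)
    have mQ: "(LINT x|S. (Q (\<lambda>x. (u x + w x) / 2) x)\<^sup>2) = (LINT x|S. ((Q u x + Q w x) / 2)\<^sup>2)"
      by (intro Bochner_Integration.integral_cong refl arg_cong[where f = "\<lambda>z. z\<^sup>2"])
        (simp add: Q_def midC field_simps)
    have mf: "2 * (LINT x|M. f x * ((u x + w x) / 2)) = (LINT x|M. f x * u x) + (LINT x|M. f x * w x)"
      using integrable_mult_square_integrable[OF f u] integrable_mult_square_integrable[OF f w]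
      by (simp add: distrib_left)
    have PP: "2 * (LINT x|M. ((P u x + P w x) / 2)\<^sup>2) + 1/2 * (LINT x|M. (A (\<lambda>x. u x - w x) x)\<^sup>2)
        = (LINT x|M. (P u x)\<^sup>2) + (LINT x|M. (P w x)\<^sup>2)"
      using integral_square_parallelogram[OF P[OF u] P[OF w]] P_diff[OF u w] by simp
    have QQ: "2 * (LINT x|S. ((Q u x + Q w x) / 2)\<^sup>2) + 1/2 * (LINT x|S. (C (\<lambda>x. u x - w x) x)\<^sup>2)
        = (LINT x|S. (Q u x)\<^sup>2) + (LINT x|S. (Q w x)\<^sup>2)"
      using integral_square_parallelogram[OF Q[OF u] Q[OF w]] Q_diff[OF u w] by simp
    have "\<kappa> * (LINT x|S. (Q u x)\<^sup>2) + \<kappa> * (LINT x|S. (Q w x)\<^sup>2) =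
        2 * (\<kappa> * (LINT x|S. ((Q u x + Q w x) / 2)\<^sup>2)) + 1/2 * (\<kappa> * (LINT x|S. (C (\<lambda>x. u x - w x) x)\<^sup>2))"
      unfolding distrib_left[symmetric] QQ[symmetric] by (simp add: algebra_simps)
    moreover have "2 * (p - 2 * m + \<kappa> * q) + c / 2 * U \<le> (p1 - 2 * m1 + q1) + (p2 - 2 * m2 + q2)"
      if "c * U \<le> dA + \<kappa> * dC" "2 * p + 1/2 * dA = p1 + p2" "2 * m = m1 + m2"
        "q1 + q2 = 2 * (\<kappa> * q) + 1/2 * (\<kappa> * dC)"
      for p m q U dA dC p1 p2 m1 m2 q1 q2 :: real
      using that by (simp add: algebra_simps)
    ultimately show ?thesis
      unfolding \<Phi> mP mQ using coercive[OF square_integrable_diff[OF u w]] PP mf by blast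
  qed

  show "(\<lambda>n. \<Phi> (u n)) \<longlonglongrightarrow> \<Phi> v"
    if u: "\<And>n. u n \<in> square_integrable M" and v: "v \<in> square_integrable M"
      and lim: "(\<lambda>n. LINT x|M. (u n x - v x)\<^sup>2) \<longlonglongrightarrow> 0" for u v
  proof -
    have "(\<lambda>n. BA * (LINT x|M. (u n x - v x)\<^sup>2)) \<longlonglongrightarrow> 0"
      using tendsto_mult_left[OF lim] by simp
    then have "(\<lambda>n. LINT x|M. (P (u n) x - P v x)\<^sup>2) \<longlonglongrightarrow> 0"
      by (rule tendsto_sandwich[OF _ _ tendsto_const, rotated 2])
        (auto simp: P_diff[OF u v] intro!: always_eventually A_bd square_integrable_diff u v)
    then have 1: "(\<lambda>n. LINT x|M. (P (u n) x)\<^sup>2) \<longlonglongrightarrow> (LINT x|M. (P v x)\<^sup>2)"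
      by (intro tendsto_integral_square_L2 P u v)
    have "(\<lambda>n. BC * (LINT x|M. (u n x - v x)\<^sup>2)) \<longlonglongrightarrow> 0"
      using tendsto_mult_left[OF lim] by simp
    then have "(\<lambda>n. LINT x|S. (Q (u n) x - Q v x)\<^sup>2) \<longlonglongrightarrow> 0"
      by (rule tendsto_sandwich[OF _ _ tendsto_const, rotated 2])
        (auto simp: Q_diff[OF u v] intro!: always_eventually C_bd square_integrable_diff u v)
    then have 2: "(\<lambda>n. LINT x|S. (Q (u n) x)\<^sup>2) \<longlonglongrightarrow> (LINT x|S. (Q v x)\<^sup>2)"
      by (intro tendsto_integral_square_L2 Q u v)
    show ?thesis
      unfolding \<Phi> by (intro tendsto_intros 1 2 tendsto_integral_mult_L2[OF f u v lim])
  qed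
qed

section \<open>Integral operators with continuous kernels\<close>

text \<open>
  Volume measure lives on the open set \<open>\<Omega>\<close> and surface measure on its boundary, while the kernels
  are continuous on the closure.  This predicate is what both measures share: functions that
  are continuous on \<open>X\<close> can be integrated against them.
\<close>

definition finite_borel_on :: "'a::euclidean_space set \<Rightarrow> 'a measure \<Rightarrow> bool" where
  "finite_borel_on X N \<longleftrightarrow> finite_measure N \<and> (\<exists>Y\<subseteq>X. sets N = sets (restrict_space borel Y))"

definition kernel_op :: "'a measure \<Rightarrow> ('a \<Rightarrow> 'a \<Rightarrow> real) \<Rightarrow> ('a \<Rightarrow> real) \<Rightarrow> 'a \<Rightarrow> real" where
  "kernel_op N k u x = (LINT y|N. k x y * u y)"

lemma finite_borel_on_measurable:
  assumes "finite_borel_on X N" and f: "continuous_on X f"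
  shows "f \<in> borel_measurable N"
proof -
  obtain Y where "Y \<subseteq> X" and s: "sets N = sets (restrict_space borel Y)"
    using assms(1) by (auto simp: finite_borel_on_def)
  then have "f \<in> borel_measurable (restrict_space borel Y)"
    using f by (intro borel_measurable_continuous_on_restrict) (rule continuous_on_subset)
  then show ?thesis by (simp add: measurable_cong_sets[OF s refl])
qed

lemma finite_borel_on_space: "finite_borel_on X N \<Longrightarrow> space N \<subseteq> X"
  by (auto simp: finite_borel_on_def space_restrict_space dest!: sets_eq_imp_space_eq)

lemma finite_borel_on_finite_measure: "finite_borel_on X N \<Longrightarrow> finite_measure N"
  by (simp add: finite_borel_on_def)

locale compact_kernel =
  fixes X :: "'a::euclidean_space set" and k :: "'a \<Rightarrow> 'a \<Rightarrow> real"
  assumes compact: "compact X" and cont: "continuous_on (X \<times> X) (\<lambda>p. k (fst p) (snd p))"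
begin

definition bound :: real where "bound = (SOME B. B \<ge> 0 \<and> (\<forall>x\<in>X. \<forall>y\<in>X. \<bar>k x y\<bar> \<le> B))"

lemma bound_nonneg: "bound \<ge> 0" and bound: "x \<in> X \<Longrightarrow> y \<in> X \<Longrightarrow> \<bar>k x y\<bar> \<le> bound"
proof -
  have "bounded ((\<lambda>p. k (fst p) (snd p)) ` (X \<times> X))"
    by (intro compact_imp_bounded compact_continuous_image cont compact_Times compact)
  then obtain B where "B > 0" "\<forall>x\<in>X. \<forall>y\<in>X. \<bar>k x y\<bar> \<le> B"
    unfolding bounded_pos by auto
  then have "\<exists>B. B \<ge> 0 \<and> (\<forall>x\<in>X. \<forall>y\<in>X. \<bar>k x y\<bar> \<le> B)" by (intro exI[of _ B]) auto
  then have "bound \<ge> 0 \<and> (\<forall>x\<in>X. \<forall>y\<in>X. \<bar>k x y\<bar> \<le> bound)"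
    unfolding bound_def by (rule someI_ex)
  then show "bound \<ge> 0" "x \<in> X \<Longrightarrow> y \<in> X \<Longrightarrow> \<bar>k x y\<bar> \<le> bound" by auto
qed

lemma continuous_slice: "x \<in> X \<Longrightarrow> continuous_on X (k x)"
  using continuous_on_compose2[OF cont continuous_on_Pair[OF continuous_on_const continuous_on_id], of x X]
  by auto

lemma integrable_kernel_mult:
  assumes N: "finite_borel_on X N" and u: "integrable N u" and x: "x \<in> X"
  shows "integrable N (\<lambda>y. k x y * u y)"
proof (rule Bochner_Integration.integrable_bound)
  show "integrable N (\<lambda>y. bound * u y)" using u by simp
  show "(\<lambda>y. k x y * u y) \<in> borel_measurable N"
    by (intro borel_measurable_times finite_borel_on_measurable[OF N] continuous_slice x
        borel_measurable_integrable u)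
  show "AE y in N. norm (k x y * u y) \<le> norm (bound * u y)"
    using finite_borel_on_space[OF N] bound[OF x] bound_nonneg
    by (intro AE_I2) (auto simp: abs_mult intro!: mult_right_mono)
qed

lemma kernel_op_le:
  assumes N: "finite_borel_on X N" and u: "integrable N u" and x: "x \<in> X"
  shows "\<bar>kernel_op N k u x\<bar> \<le> bound * (LINT y|N. \<bar>u y\<bar>)"
proof -
  have "\<bar>kernel_op N k u x\<bar> \<le> (LINT y|N. \<bar>k x y * u y\<bar>)"
    unfolding kernel_op_def by (rule integral_abs_bound)
  also have "\<dots> \<le> (LINT y|N. bound * \<bar>u y\<bar>)"
    using finite_borel_on_space[OF N] bound[OF x]
    by (intro integral_mono integrable_abs integrable_kernel_mult N u x)
      (auto simp: abs_mult u intro!: mult_right_mono)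
  finally show ?thesis by simp
qed

text \<open>
  Uniform continuity of the kernel on the compact set \<open>X \<times> X\<close> gives a modulus of continuity that
  depends on \<open>u\<close> only through its \<open>L\<^sup>1\<close> norm.
\<close>

lemma kernel_op_equicontinuous:
  assumes N: "finite_borel_on X N" and e: "e > 0"
  obtains d where "d > 0" "\<And>x x' u. x \<in> X \<Longrightarrow> x' \<in> X \<Longrightarrow> dist x x' < d \<Longrightarrow> integrable N u \<Longrightarrow>
    \<bar>kernel_op N k u x - kernel_op N k u x'\<bar> \<le> e * (LINT y|N. \<bar>u y\<bar>)"
proof -
  have "uniformly_continuous_on (X \<times> X) (\<lambda>p. k (fst p) (snd p))"
    by (intro compact_uniformly_continuous cont compact_Times compact)
  then obtain d where d: "d > 0" and
    dd: "\<And>p q. p \<in> X \<times> X \<Longrightarrow> q \<in> X \<times> X \<Longrightarrow> dist q p < d \<Longrightarrow> dist (k (fst q) (snd q)) (k (fst p) (snd p)) < e"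
    unfolding uniformly_continuous_on_def using e by metis
  show thesis
  proof (rule that[OF d])
    fix x x' and u :: "'a \<Rightarrow> real" assume x: "x \<in> X" and x': "x' \<in> X" and xx: "dist x x' < d" and u: "integrable N u"
    have le: "\<bar>k x y - k x' y\<bar> \<le> e" if "y \<in> X" for y
      using dd[of "(x', y)" "(x, y)"] that x x' xx by (simp add: dist_prod_def dist_real_def)
    have "kernel_op N k u x - kernel_op N k u x' = (LINT y|N. (k x y - k x' y) * u y)"
      unfolding kernel_op_def
      using integrable_kernel_mult[OF N u x] integrable_kernel_mult[OF N u x']
      by (simp add: left_diff_distrib)
    also have "\<bar>\<dots>\<bar> \<le> (LINT y|N. \<bar>(k x y - k x' y) * u y\<bar>)" by (rule integral_abs_bound)
    also have "\<dots> \<le> (LINT y|N. e * \<bar>u y\<bar>)"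
    proof (rule integral_mono)
      show "integrable N (\<lambda>y. \<bar>(k x y - k x' y) * u y\<bar>)"
        using integrable_kernel_mult[OF N u x] integrable_kernel_mult[OF N u x']
        unfolding left_diff_distrib by (intro integrable_abs Bochner_Integration.integrable_diff)
      show "integrable N (\<lambda>y. e * \<bar>u y\<bar>)" using u by simp
      show "\<bar>(k x y - k x' y) * u y\<bar> \<le> e * \<bar>u y\<bar>" if "y \<in> space N" for y
        using that finite_borel_on_space[OF N] le[of y] by (auto simp: abs_mult intro!: mult_right_mono)
    qed
    finally show "\<bar>kernel_op N k u x - kernel_op N k u x'\<bar> \<le> e * (LINT y|N. \<bar>u y\<bar>)" by simp
  qed
qed

lemma continuous_kernel_op:
  assumes N: "finite_borel_on X N" and u: "integrable N u"
  shows "continuous_on X (kernel_op N k u)"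
  unfolding continuous_on_iff
proof (intro ballI allI impI)
  fix x and e :: real assume x: "x \<in> X" and e: "e > 0"
  define I where "I = (LINT y|N. \<bar>u y\<bar>)"
  have I: "I \<ge> 0" unfolding I_def by simp
  have "e / (I + 1) > 0" using e I by simp
  obtain d where d: "d > 0" "\<And>x x'. x \<in> X \<Longrightarrow> x' \<in> X \<Longrightarrow> dist x x' < d \<Longrightarrow>
      \<bar>kernel_op N k u x - kernel_op N k u x'\<bar> \<le> e / (I + 1) * I"
    unfolding I_def
    using kernel_op_equicontinuous[OF N \<open>e / (I + 1) > 0\<close>] u unfolding I_def by metis
  have "e / (I + 1) * I < e" using e I by (simp add: field_simps)
  then show "\<exists>d>0. \<forall>x'\<in>X. dist x' x < d \<longrightarrow> dist (kernel_op N k u x') (kernel_op N k u x) < e"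
    using d x by (intro exI[of _ d]) (force simp: dist_real_def)
qed

lemma kernel_op_lincomb:
  assumes N: "finite_borel_on X N" and u: "integrable N u" and v: "integrable N v" and x: "x \<in> X"
  shows "kernel_op N k (\<lambda>y. s * u y + t * v y) x = s * kernel_op N k u x + t * kernel_op N k v x"
proof -
  have "(\<lambda>y. k x y * (s * u y + t * v y)) = (\<lambda>y. s * (k x y * u y) + t * (k x y * v y))"
    by (simp add: algebra_simps)
  then show ?thesis
    unfolding kernel_op_def
    using integrable_kernel_mult[OF N u x] integrable_kernel_mult[OF N v x] by simp
qed

lemma kernel_op_diff:
  assumes "finite_borel_on X N" "integrable N u" "integrable N v" "x \<in> X"
  shows "kernel_op N k (\<lambda>y. u y - v y) x = kernel_op N k u x - kernel_op N k v x"
  using kernel_op_lincomb[OF assms, of 1 "-1"] by simp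

lemma kernel_op_power2_le:
  assumes N: "finite_borel_on X N" and u: "u \<in> square_integrable N" and x: "x \<in> X"
  shows "(kernel_op N k u x)\<^sup>2 \<le> bound\<^sup>2 * measure N (space N) * (LINT y|N. (u y)\<^sup>2)"
proof -
  interpret finite_measure N by (rule finite_borel_on_finite_measure[OF N])
  have "(kernel_op N k u x)\<^sup>2 \<le> (bound * (LINT y|N. \<bar>u y\<bar>))\<^sup>2"
    using kernel_op_le[OF N integrable_square_integrable[OF u] x]
    by (metis abs_ge_zero power2_abs power_mono)
  also have "\<dots> \<le> bound\<^sup>2 * (measure N (space N) * (LINT y|N. (u y)\<^sup>2))"
    unfolding power_mult_distrib
    by (intro mult_left_mono integral_abs_power2_le u) auto
  finally show ?thesis by (simp add: mult.assoc)
qed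

lemma kernel_op_square_integrable:
  assumes N: "finite_borel_on X N" and S: "finite_borel_on X S" and u: "integrable N u"
  shows "kernel_op N k u \<in> square_integrable S"
proof -
  interpret S: finite_measure S by (rule finite_borel_on_finite_measure[OF S])
  show ?thesis
    by (rule S.square_integrable_bounded[where B = "bound * (LINT y|N. \<bar>u y\<bar>)"])
      (use finite_borel_on_measurable[OF S continuous_kernel_op[OF N u]]
        kernel_op_le[OF N u] finite_borel_on_space[OF S] in auto)
qed

lemma integral_kernel_op_power2_le:
  assumes N: "finite_borel_on X N" and S: "finite_borel_on X S" and u: "u \<in> square_integrable N"
  shows "(LINT x|S. (kernel_op N k u x)\<^sup>2)
    \<le> (bound\<^sup>2 * measure N (space N) * measure S (space S)) * (LINT y|N. (u y)\<^sup>2)"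
proof -
  interpret finite_measure N by (rule finite_borel_on_finite_measure[OF N])
  interpret S: finite_measure S by (rule finite_borel_on_finite_measure[OF S])
  let ?c = "bound\<^sup>2 * measure N (space N) * (LINT y|N. (u y)\<^sup>2)"
  have "(LINT x|S. (kernel_op N k u x)\<^sup>2) \<le> (LINT x|S. ?c)"
    using kernel_op_power2_le[OF N u] finite_borel_on_space[OF S]
      square_integrableD(2)[OF kernel_op_square_integrable[OF N S integrable_square_integrable[OF u]]]
    by (intro integral_mono) auto
  then show ?thesis by (simp add: mult_ac)
qed

text \<open>
  The operator is compact from \<open>L\<^sup>2\<close> to the continuous functions, by Arzela-Ascoli.
\<close>

lemma kernel_op_compact:
  assumes N: "finite_borel_on X N" and u: "\<And>n. u n \<in> square_integrable N"
    and bd: "\<And>n. (LINT y|N. (u n y)\<^sup>2) \<le> 1"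
  obtains g s where "continuous_on X g" "strict_mono (s :: nat \<Rightarrow> nat)"
    "\<And>e. e > 0 \<Longrightarrow> \<exists>n0. \<forall>n\<ge>n0. \<forall>x\<in>X. \<bar>kernel_op N k (u (s n)) x - g x\<bar> < e"
proof -
  interpret finite_measure N by (rule finite_borel_on_finite_measure[OF N])
  define V where "V = sqrt (measure N (space N))"
  have V: "V \<ge> 0" by (simp add: V_def)
  have int: "integrable N (u n)" for n by (rule integrable_square_integrable[OF u])
  have L1: "(LINT y|N. \<bar>u n y\<bar>) \<le> V" for n
  proof (rule power2_le_imp_le)
    have "(LINT y|N. \<bar>u n y\<bar>)\<^sup>2 \<le> measure N (space N) * (LINT y|N. (u n y)\<^sup>2)"
      by (rule integral_abs_power2_le[OF u])
    also have "\<dots> \<le> measure N (space N) * 1" by (intro mult_left_mono bd) simp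
    finally show "(LINT y|N. \<bar>u n y\<bar>)\<^sup>2 \<le> V\<^sup>2" by (simp add: V_def)
  qed (fact V)
  obtain g s where gs: "continuous_on X g" "strict_mono (s :: nat \<Rightarrow> nat)"
    "\<And>e. e > 0 \<Longrightarrow> \<exists>n0. \<forall>n x. n \<ge> n0 \<and> x \<in> X \<longrightarrow> norm (kernel_op N k (u (s n)) x - g x) < e"
  proof (rule Arzela_Ascoli[OF compact, of "\<lambda>n. kernel_op N k (u n)" "bound * V"])
    show "norm (kernel_op N k (u n) x) \<le> bound * V" if "x \<in> X" for n x
      using kernel_op_le[OF N int that, of n] mult_left_mono[OF L1 bound_nonneg, of n]
      unfolding real_norm_def by linarith
    show "\<exists>d>0. \<forall>n y. y \<in> X \<and> norm (x - y) < d \<longrightarrow>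
        norm (kernel_op N k (u n) x - kernel_op N k (u n) y) < e" if x: "x \<in> X" and e: "0 < e" for x e
    proof -
      have "e / (V + 1) > 0" using e V by simp
      then obtain d where d: "d > 0" "\<And>x x' u. x \<in> X \<Longrightarrow> x' \<in> X \<Longrightarrow> dist x x' < d \<Longrightarrow> integrable N u \<Longrightarrow>
        \<bar>kernel_op N k u x - kernel_op N k u x'\<bar> \<le> e / (V + 1) * (LINT y|N. \<bar>u y\<bar>)"
        using kernel_op_equicontinuous[OF N] by blast
      show ?thesis
      proof (intro exI conjI allI impI)
        fix n y assume y: "y \<in> X \<and> norm (x - y) < d"
        have "\<bar>kernel_op N k (u n) x - kernel_op N k (u n) y\<bar> \<le> e / (V + 1) * (LINT y|N. \<bar>u n y\<bar>)"
          using d(2)[OF x _ _ int] y by (simp add: dist_norm)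
        also have "\<dots> \<le> e / (V + 1) * V"
          by (intro mult_left_mono L1) (use e V in auto)
        also have "\<dots> < e" using e V by (simp add: field_simps)
        finally show "norm (kernel_op N k (u n) x - kernel_op N k (u n) y) < e" by simp
      qed (fact d)
    qed
  qed auto
  show thesis by (rule that[OF gs(1,2)]) (use gs(3) in \<open>force\<close>)
qed

end

section \<open>Coercivity by compactness\<close>

text \<open>
  For the operator \<open>u \<mapsto> w u - T u\<close>, a positive multiplication operator minus a compact one,
  injectivity implies a lower bound.  It suffices to know injectivity on continuous functions,
  and with the equation valid at every point of \<open>X\<close>, because the limit of a sequence
  violating the bound is \<open>g / w\<close> with \<open>g\<close> a uniform limit of functions \<open>T u\<^sub>n\<close>.
\<close>

theorem kernel_op_coercive:
  assumes k: "compact_kernel X k" and k': "compact_kernel X k'"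
    and M: "finite_borel_on X M" and S: "finite_borel_on X S"
    and w: "continuous_on X w" "\<And>x. x \<in> X \<Longrightarrow> w x > 0"
    and \<alpha>: "\<alpha> > 0" and \<beta>: "\<beta> > 0"
    and injective: "\<And>v. continuous_on X v \<Longrightarrow> (\<And>x. x \<in> X \<Longrightarrow> w x * v x = kernel_op M k v x) \<Longrightarrow>
      (AE x in S. kernel_op M k' v x = 0) \<Longrightarrow> (AE x in M. v x = 0)"
  shows "\<exists>c>0. \<forall>u\<in>square_integrable M. c * (LINT x|M. (u x)\<^sup>2) \<le>
    \<alpha> * (LINT x|M. (w x * u x - kernel_op M k u x)\<^sup>2) + \<beta> * (LINT x|S. (kernel_op M k' u x)\<^sup>2)"
proof (rule ccontr)
  interpret k: compact_kernel X k by fact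
  interpret k': compact_kernel X k' by fact
  interpret M: finite_measure M by (rule finite_borel_on_finite_measure[OF M])
  interpret S: finite_measure S by (rule finite_borel_on_finite_measure[OF S])
  let ?T = "kernel_op M k"
  let ?T' = "kernel_op M k'"
  define P where "P u = (LINT x|M. (w x * u x - ?T u x)\<^sup>2)" for u
  define Q where "Q u = (LINT x|S. (?T' u x)\<^sup>2)" for u
  have P0: "P u \<ge> 0" and Q0: "Q u \<ge> 0" for u by (simp_all add: P_def Q_def)
  assume contra: "\<not> (\<exists>c>0. \<forall>u\<in>square_integrable M. c * (LINT x|M. (u x)\<^sup>2) \<le>
    \<alpha> * (LINT x|M. (w x * u x - ?T u x)\<^sup>2) + \<beta> * (LINT x|S. (?T' u x)\<^sup>2))"
  have spX: "space M \<subseteq> X" "space S \<subseteq> X" using finite_borel_on_space M S by auto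

  have "\<exists>u\<in>square_integrable M. (LINT x|M. (u x)\<^sup>2) = 1 \<and> \<alpha> * P u + \<beta> * Q u < 1 / (real n + 1)" for n
  proof -
    have "1 / (real n + 1) > 0" by simp
    with contra obtain u where u: "u \<in> square_integrable M"
      and lt: "\<alpha> * P u + \<beta> * Q u < 1 / (real n + 1) * (LINT x|M. (u x)\<^sup>2)"
      unfolding P_def Q_def by (meson not_le)
    define U where "U = (LINT x|M. (u x)\<^sup>2)"
    define r where "r = 1 / sqrt U"
    have "0 \<le> \<alpha> * P u + \<beta> * Q u" using \<alpha> \<beta> P0 Q0 by simp
    with lt have "0 < 1 / (real n + 1) * U" unfolding U_def by linarith
    then have U: "U > 0" by (simp add: zero_less_divide_iff)
    have r2: "r\<^sup>2 = 1 / U" using U by (simp add: r_def power_divide)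
    have T: "?T (\<lambda>x. r * u x) x = r * ?T u x" and T': "?T' (\<lambda>x. r * u x) x = r * ?T' u x" for x
      by (simp_all add: kernel_op_def mult.left_commute[of _ r])
    have "(w x * (r * u x) - r * ?T u x)\<^sup>2 = r\<^sup>2 * (w x * u x - ?T u x)\<^sup>2" for x
      by (simp add: power2_eq_square algebra_simps)
    then have "P (\<lambda>x. r * u x) = r\<^sup>2 * P u" "Q (\<lambda>x. r * u x) = r\<^sup>2 * Q u"
      by (simp_all add: P_def Q_def T T' power_mult_distrib)
    then have "\<alpha> * P (\<lambda>x. r * u x) + \<beta> * Q (\<lambda>x. r * u x) = (\<alpha> * P u + \<beta> * Q u) / U"
      by (simp add: r2 add_divide_distrib)
    also have "\<dots> < 1 / (real n + 1)" using lt U by (simp add: U_def[symmetric] field_simps)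
    finally have "\<alpha> * P (\<lambda>x. r * u x) + \<beta> * Q (\<lambda>x. r * u x) < 1 / (real n + 1)" .
    moreover have "(LINT x|M. (r * u x)\<^sup>2) = 1"
      using U by (simp add: power_mult_distrib r2 U_def[symmetric])
    ultimately show ?thesis using square_integrable_scale[OF u, of r] by auto
  qed
  then obtain u where u: "\<And>n. u n \<in> square_integrable M" and u1: "\<And>n. (LINT x|M. (u n x)\<^sup>2) = 1"
    and small: "\<And>n. \<alpha> * P (u n) + \<beta> * Q (u n) < 1 / (real n + 1)"
    by metis
  have inv_lim: "(\<lambda>n. 1 / (real n + 1) / c) \<longlonglongrightarrow> 0" for c
    using tendsto_divide[OF LIMSEQ_inverse_real_of_nat tendsto_const[of c]]
    by (cases "c = 0") (auto simp: inverse_eq_divide add.commute)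
  have P_lim: "(\<lambda>n. P (u n)) \<longlonglongrightarrow> 0"
  proof (rule tendsto_sandwich[OF _ _ tendsto_const inv_lim[of \<alpha>]])
    have "P (u n) \<le> 1 / (real n + 1) / \<alpha>" for n
    proof -
      have "\<alpha> * P (u n) < 1 / (real n + 1)" using small[of n] mult_nonneg_nonneg[OF less_imp_le[OF \<beta>] Q0[of "u n"]] by linarith
      then show ?thesis
        unfolding pos_le_divide_eq[OF \<alpha>] mult.commute[of "P (u n)"] by (rule less_imp_le)
    qed
    then show "\<forall>\<^sub>F n in sequentially. P (u n) \<le> 1 / (real n + 1) / \<alpha>" by simp
  qed (simp add: P0)
  have Q_lim: "(\<lambda>n. Q (u n)) \<longlonglongrightarrow> 0"
  proof (rule tendsto_sandwich[OF _ _ tendsto_const inv_lim[of \<beta>]])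
    have "Q (u n) \<le> 1 / (real n + 1) / \<beta>" for n
    proof -
      have "\<beta> * Q (u n) < 1 / (real n + 1)" using small[of n] mult_nonneg_nonneg[OF less_imp_le[OF \<alpha>] P0[of "u n"]] by linarith
      then show ?thesis
        unfolding pos_le_divide_eq[OF \<beta>] mult.commute[of "Q (u n)"] by (rule less_imp_le)
    qed
    then show "\<forall>\<^sub>F n in sequentially. Q (u n) \<le> 1 / (real n + 1) / \<beta>" by simp
  qed (simp add: Q0)

  have u_le: "(LINT x|M. (u n x)\<^sup>2) \<le> 1" for n by (simp add: u1)
  obtain g s where g: "continuous_on X g" and s: "strict_mono (s :: nat \<Rightarrow> nat)"
    and unif: "\<And>e. e > 0 \<Longrightarrow> \<exists>n0. \<forall>n\<ge>n0. \<forall>x\<in>X. \<bar>?T (u (s n)) x - g x\<bar> < e"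
    by (rule k.kernel_op_compact[of M u, OF M u u_le]) (rule that)
  (* w u_n - T u_n tends to 0 and T u_n tends to g, so this is the only possible limit of u_n *)
  define v where "v x = g x / w x" for x
  have v: "continuous_on X v"
    unfolding v_def using w(2) by (intro continuous_on_divide g w(1)) (metis less_irrefl)
  define a where "a n x = u (s n) x - v x" for n x

  have cont_SI: "h \<in> square_integrable M" if "continuous_on X h" for h
  proof -
    have "bounded (h ` X)" by (intro compact_imp_bounded compact_continuous_image that k.compact)
    then obtain B where "\<forall>x\<in>X. \<bar>h x\<bar> \<le> B" unfolding bounded_iff by auto
    then show ?thesis
      using finite_borel_on_measurable[OF M that] spX
      by (intro M.square_integrable_bounded[where B = B]) auto
  qed
  have vS: "v \<in> square_integrable M" by (rule cont_SI[OF v])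
  have aS: "a n \<in> square_integrable M" for n unfolding a_def by (intro square_integrable_diff u vS)
  have TS: "?T h \<in> square_integrable M" if "h \<in> square_integrable M" for h
    by (rule k.kernel_op_square_integrable[OF M M M.integrable_square_integrable[OF that]])

  have Tg_lim: "(\<lambda>n. LINT x|M. (?T (u (s n)) x - g x)\<^sup>2) \<longlonglongrightarrow> 0"
  proof (rule LIMSEQ_I)
    fix r :: real assume r: "r > 0"
    let ?V = "measure M (space M)"
    define e where "e = sqrt (r / (?V + 1))"
    have V: "?V \<ge> 0" by simp
    then have V1: "?V + 1 > 0" by linarith
    then have "r / (?V + 1) > 0" using r by (rule divide_pos_pos[rotated])
    then have e: "e > 0" "e\<^sup>2 = r / (?V + 1)" by (simp_all add: e_def)
    then obtain n0 where n0: "\<And>n x. n \<ge> n0 \<Longrightarrow> x \<in> X \<Longrightarrow> \<bar>?T (u (s n)) x - g x\<bar> < e" using unif by blast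
    show "\<exists>n0. \<forall>n\<ge>n0. norm ((LINT x|M. (?T (u (s n)) x - g x)\<^sup>2) - 0) < r"
    proof (intro exI allI impI)
      fix n assume n: "n \<ge> n0"
      have "(LINT x|M. (?T (u (s n)) x - g x)\<^sup>2) \<le> (LINT x|M. e\<^sup>2)"
      proof (rule integral_mono)
        show "integrable M (\<lambda>x. (?T (u (s n)) x - g x)\<^sup>2)"
          by (intro square_integrableD square_integrable_diff TS u cont_SI g)
        fix x assume "x \<in> space M"
        then have "\<bar>?T (u (s n)) x - g x\<bar> < e" using n0[OF n] spX by auto
        then have "\<bar>?T (u (s n)) x - g x\<bar>\<^sup>2 \<le> e\<^sup>2" by (intro power_mono) auto
        then show "(?T (u (s n)) x - g x)\<^sup>2 \<le> e\<^sup>2" by simp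
      qed simp
      also have "\<dots> = r * (?V / (?V + 1))" by (simp add: e)
      also have "\<dots> < r * 1" using r V1 by (intro mult_strict_left_mono) (simp_all add: divide_less_eq)
      finally show "norm ((LINT x|M. (?T (u (s n)) x - g x)\<^sup>2) - 0) < r" by simp
    qed
  qed

  (* w (u_n - v) = (w u_n - T u_n) + (T u_n - g) turns into a bound on u_n - v once w is bounded below *)
  have "\<exists>m>0. \<forall>x\<in>X. m \<le> w x"
  proof (cases "X = {}")
    case False
    then obtain x0 where "x0 \<in> X" "\<forall>x\<in>X. w x0 \<le> w x"
      using continuous_attains_inf[OF k.compact _ w(1)] by blast
    then show ?thesis using w(2) by blast
  qed (auto intro: exI[of _ 1])
  then obtain m where m: "m > 0" "\<And>x. x \<in> X \<Longrightarrow> m \<le> w x" by blast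

  have wS: "(\<lambda>x. w x * h x) \<in> square_integrable M" if "h \<in> square_integrable M" for h
  proof -
    have "bounded (w ` X)" by (intro compact_imp_bounded compact_continuous_image w k.compact)
    then obtain B where "\<forall>x\<in>X. \<bar>w x\<bar> \<le> B" unfolding bounded_iff by auto
    then show ?thesis
      using finite_borel_on_measurable[OF M w(1)] spX that
      by (intro M.square_integrable_mult_bounded[where B = B]) auto
  qed
  have a_le: "m\<^sup>2 * (LINT x|M. (a n x)\<^sup>2) \<le> 2 * P (u (s n)) + 2 * (LINT x|M. (?T (u (s n)) x - g x)\<^sup>2)" for n
  proof -
    have "m\<^sup>2 * (LINT x|M. (a n x)\<^sup>2) = (LINT x|M. m\<^sup>2 * (a n x)\<^sup>2)" by simp
    also have "\<dots> \<le> (LINT x|M. ((w x * u (s n) x - ?T (u (s n)) x) + (?T (u (s n)) x - g x))\<^sup>2)"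
    proof (rule integral_mono)
      show "integrable M (\<lambda>x. m\<^sup>2 * (a n x)\<^sup>2)" using square_integrableD(2)[OF aS] by simp
      show "integrable M (\<lambda>x. ((w x * u (s n) x - ?T (u (s n)) x) + (?T (u (s n)) x - g x))\<^sup>2)"
        by (intro square_integrableD square_integrable_add square_integrable_diff TS u cont_SI g wS)
      fix x assume "x \<in> space M"
      then have x: "x \<in> X" using spX by auto
      have "((w x * u (s n) x - ?T (u (s n)) x) + (?T (u (s n)) x - g x)) = w x * a n x"
        using w(2)[OF x] by (simp add: a_def v_def field_simps)
      moreover have "m\<^sup>2 \<le> (w x)\<^sup>2" using m(1) m(2)[OF x] by (intro power_mono) auto
      ultimately show "m\<^sup>2 * (a n x)\<^sup>2 \<le> ((w x * u (s n) x - ?T (u (s n)) x) + (?T (u (s n)) x - g x))\<^sup>2"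
        by (simp add: power_mult_distrib mult_right_mono)
    qed
    also have "\<dots> \<le> 2 * P (u (s n)) + 2 * (LINT x|M. (?T (u (s n)) x - g x)\<^sup>2)"
      unfolding P_def
      by (intro integral_square_add_le square_integrable_diff TS u cont_SI g wS)
    finally show ?thesis .
  qed
  have a_lim: "(\<lambda>n. LINT x|M. (a n x)\<^sup>2) \<longlonglongrightarrow> 0"
  proof (rule tendsto_sandwich[OF _ _ tendsto_const])
    have "(\<lambda>n. P (u (s n))) \<longlonglongrightarrow> 0" using LIMSEQ_subseq_LIMSEQ[OF P_lim s] by (simp add: o_def)
    then show "(\<lambda>n. (2 * P (u (s n)) + 2 * (LINT x|M. (?T (u (s n)) x - g x)\<^sup>2)) / m\<^sup>2) \<longlonglongrightarrow> 0"
      using m(1) by (auto intro!: tendsto_eq_intros Tg_lim)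
    show "\<forall>\<^sub>F n in sequentially. (LINT x|M. (a n x)\<^sup>2) \<le>
        (2 * P (u (s n)) + 2 * (LINT x|M. (?T (u (s n)) x - g x)\<^sup>2)) / m\<^sup>2"
      using a_le m(1) by (intro always_eventually allI) (simp add: pos_le_divide_eq mult.commute)
  qed auto
  have "(\<lambda>n. LINT x|M. (u (s n) x)\<^sup>2) \<longlonglongrightarrow> (LINT x|M. (v x)\<^sup>2)"
    by (rule tendsto_integral_square_L2[OF u vS a_lim[unfolded a_def]])
  then have v1: "(LINT x|M. (v x)\<^sup>2) = 1"
    by (simp add: u1 LIMSEQ_const_iff)

  have T_diff: "?T (a n) x = ?T (u (s n)) x - ?T v x" if "x \<in> X" for n x
    unfolding a_def by (intro k.kernel_op_diff M that M.integrable_square_integrable u vS)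
  have T'_diff: "?T' (a n) x = ?T' (u (s n)) x - ?T' v x" if "x \<in> X" for n x
    unfolding a_def by (intro k'.kernel_op_diff M that M.integrable_square_integrable u vS)

  have fixed: "w x * v x = ?T v x" if x: "x \<in> X" for x
  proof -
    have "(\<lambda>n. k.bound\<^sup>2 * measure M (space M) * (LINT x|M. (a n x)\<^sup>2)) \<longlonglongrightarrow> 0"
      using tendsto_mult_left[OF a_lim] by simp
    then have "(\<lambda>n. (?T (a n) x)\<^sup>2) \<longlonglongrightarrow> 0"
      by (rule tendsto_sandwich[OF _ _ tendsto_const, rotated 2])
        (auto intro!: always_eventually k.kernel_op_power2_le M aS x)
    then have "(\<lambda>n. ?T (u (s n)) x - ?T v x) \<longlonglongrightarrow> 0"
      by (simp add: T_diff[OF x])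
    then have "(\<lambda>n. ?T (u (s n)) x) \<longlonglongrightarrow> ?T v x" by (rule LIM_zero_cancel)
    moreover have "(\<lambda>n. ?T (u (s n)) x) \<longlonglongrightarrow> g x"
      by (rule LIMSEQ_I) (use unif x in \<open>fastforce\<close>)
    ultimately have "g x = ?T v x" using LIMSEQ_unique by blast
    then show ?thesis using w(2)[OF x] by (simp add: v_def)
  qed

  have boundary: "AE x in S. ?T' v x = 0"
  proof -
    have T'S: "?T' h \<in> square_integrable S" if "h \<in> square_integrable M" for h
      by (rule k'.kernel_op_square_integrable[OF M S M.integrable_square_integrable[OF that]])
    have "(\<lambda>n. (k'.bound\<^sup>2 * measure M (space M) * measure S (space S)) * (LINT x|M. (a n x)\<^sup>2)) \<longlonglongrightarrow> 0"
      using tendsto_mult_left[OF a_lim] by simp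
    then have "(\<lambda>n. LINT x|S. (?T' (a n) x)\<^sup>2) \<longlonglongrightarrow> 0"
      by (rule tendsto_sandwich[OF _ _ tendsto_const, rotated 2])
        (auto intro!: always_eventually k'.integral_kernel_op_power2_le M S aS)
    moreover have "(LINT x|S. (?T' (a n) x)\<^sup>2) = (LINT x|S. (?T' (u (s n)) x - ?T' v x)\<^sup>2)" for n
      using T'_diff spX by (intro Bochner_Integration.integral_cong) auto
    ultimately have "(\<lambda>n. LINT x|S. (?T' (u (s n)) x - ?T' v x)\<^sup>2) \<longlonglongrightarrow> 0" by simp
    then have "(\<lambda>n. Q (u (s n))) \<longlonglongrightarrow> Q v"
      unfolding Q_def by (intro tendsto_integral_square_L2 T'S u vS)
    moreover have "(\<lambda>n. Q (u (s n))) \<longlonglongrightarrow> 0" using LIMSEQ_subseq_LIMSEQ[OF Q_lim s] by (simp add: o_def)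
    ultimately have "Q v = 0" using LIMSEQ_unique by blast
    then show ?thesis
      unfolding Q_def by (rule AE_eq_0_if_integral_square_eq_0[OF T'S[OF vS]])
  qed
  have "AE x in M. v x = 0" by (rule injective[OF v fixed boundary])
  then have "(LINT x|M. (v x)\<^sup>2) = 0"
    by (intro integral_eq_zero_AE) auto
  with v1 show False by simp
qed

text \<open>
  Compactness supplies the coercivity that makes the quadratic functional strongly convex.
\<close>

theorem kernel_functional_arg_min:
  assumes k: "compact_kernel X k" and k': "compact_kernel X k'"
    and M: "finite_borel_on X M" and S: "finite_borel_on X S"
    and w: "continuous_on X w" "\<And>x. x \<in> X \<Longrightarrow> w x > 0"
    and s: "s > 0" and \<kappa>: "\<kappa> > 0"
    and injective: "\<And>v. continuous_on X v \<Longrightarrow> (\<And>x. x \<in> X \<Longrightarrow> w x * v x = kernel_op M k v x) \<Longrightarrow>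
      (AE x in S. kernel_op M k' v x = 0) \<Longrightarrow> (AE x in M. v x = 0)"
    and f: "f \<in> square_integrable M" and g: "g \<in> square_integrable M" and h: "h \<in> square_integrable S"
  defines "\<Phi> \<equiv> \<lambda>u. (LINT x|M. (s * (w x * u x - kernel_op M k u x) - g x)\<^sup>2)
      - 2 * (LINT x|M. f x * u x) + \<kappa> * (LINT x|S. (h x - kernel_op M k' u x)\<^sup>2)"
  shows "\<exists>u. is_arg_min \<Phi> (\<lambda>v. v \<in> square_integrable M) u \<and>
    (\<forall>v. is_arg_min \<Phi> (\<lambda>v. v \<in> square_integrable M) v \<longrightarrow> (AE x in M. v x = u x))"
proof -
  interpret k: compact_kernel X k by fact
  interpret k': compact_kernel X k' by fact
  interpret M: finite_measure M by (rule finite_borel_on_finite_measure[OF M])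
  have spX: "space M \<subseteq> X" "space S \<subseteq> X" using finite_borel_on_space M S by auto
  let ?T = "kernel_op M k"
  have "bounded (w ` X)" by (intro compact_imp_bounded compact_continuous_image w k.compact)
  then obtain W where W: "\<And>x. x \<in> X \<Longrightarrow> \<bar>w x\<bar> \<le> W" unfolding bounded_iff by auto
  have wSI: "(\<lambda>x. w x * u x) \<in> square_integrable M" if "u \<in> square_integrable M" for u
    using that finite_borel_on_measurable[OF M w(1)] spX W
    by (intro M.square_integrable_mult_bounded[where B = W]) auto
  have TSI: "?T u \<in> square_integrable M" if "u \<in> square_integrable M" for u
    by (rule k.kernel_op_square_integrable[OF M M M.integrable_square_integrable[OF that]])
  define A where "A u x = s * (w x * u x - ?T u x)" for u x
  have ASI: "A u \<in> square_integrable M" if "u \<in> square_integrable M" for u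
    unfolding A_def by (intro square_integrable_scale square_integrable_diff wSI TSI that)
  have "s\<^sup>2 > 0" using s by simp
  then obtain c where c: "c > 0" and coercive: "\<And>u. u \<in> square_integrable M \<Longrightarrow> c * (LINT x|M. (u x)\<^sup>2) \<le>
    s\<^sup>2 * (LINT x|M. (w x * u x - ?T u x)\<^sup>2) + \<kappa> * (LINT x|S. (kernel_op M k' u x)\<^sup>2)"
    using kernel_op_coercive[OF k k' M S w _ \<kappa> injective] by blast
  let ?BT = "k.bound\<^sup>2 * measure M (space M) * measure M (space M)"
  show ?thesis
    unfolding \<Phi>_def A_def[symmetric]
  proof (rule M.quadratic_functional_arg_min[OF ASI _ _ _ _ _ c less_imp_le[OF \<kappa>] _ f g h])
    fix u assume u: "u \<in> square_integrable M"
    note int = M.integrable_square_integrable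
    show "kernel_op M k' u \<in> square_integrable S"
      by (rule k'.kernel_op_square_integrable[OF M S int[OF u]])
    show "(LINT x|S. (kernel_op M k' u x)\<^sup>2) \<le>
        (k'.bound\<^sup>2 * measure M (space M) * measure S (space S)) * (LINT x|M. (u x)\<^sup>2)"
      by (rule k'.integral_kernel_op_power2_le[OF M S u])
    show "(LINT x|M. (A u x)\<^sup>2) \<le> s\<^sup>2 * (2 * W\<^sup>2 + 2 * ?BT) * (LINT x|M. (u x)\<^sup>2)"
    proof -
      have "(LINT x|M. (w x * u x)\<^sup>2) \<le> (LINT x|M. W\<^sup>2 * (u x)\<^sup>2)"
      proof (rule integral_mono)
        fix x assume "x \<in> space M"
        then have "(w x)\<^sup>2 \<le> W\<^sup>2" using W[of x] spX power_mono[of "\<bar>w x\<bar>" W 2] by auto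
        then show "(w x * u x)\<^sup>2 \<le> W\<^sup>2 * (u x)\<^sup>2" by (simp add: power_mult_distrib mult_right_mono)
      qed (use square_integrableD(2)[OF wSI[OF u]] square_integrableD(2)[OF u] in auto)
      then have "(LINT x|M. (w x * u x + (-1) * ?T u x)\<^sup>2)
          \<le> 2 * (W\<^sup>2 * (LINT x|M. (u x)\<^sup>2)) + 2 * (?BT * (LINT x|M. (u x)\<^sup>2))"
        using integral_square_add_le[OF wSI[OF u] square_integrable_scale[OF TSI[OF u], of "-1"]]
          k.integral_kernel_op_power2_le[OF M M u] by simp
      then have "s\<^sup>2 * (LINT x|M. (w x * u x - ?T u x)\<^sup>2)
          \<le> s\<^sup>2 * (2 * (W\<^sup>2 * (LINT x|M. (u x)\<^sup>2)) + 2 * (?BT * (LINT x|M. (u x)\<^sup>2)))"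
        by (intro mult_left_mono) auto
      moreover have "(LINT x|M. (A u x)\<^sup>2) = s\<^sup>2 * (LINT x|M. (w x * u x - ?T u x)\<^sup>2)"
        by (simp add: A_def power_mult_distrib)
      ultimately show ?thesis by (simp add: algebra_simps)
    qed
    show "c * (LINT x|M. (u x)\<^sup>2) \<le> (LINT x|M. (A u x)\<^sup>2) + \<kappa> * (LINT x|S. (kernel_op M k' u x)\<^sup>2)"
      using coercive[OF u] by (simp add: A_def power_mult_distrib)
    fix v assume v: "v \<in> square_integrable M"
    show "A (\<lambda>x. s * u x + t * v x) x = s * A u x + t * A v x" if "x \<in> space M" for x s t
    proof -
      have "x \<in> X" using that spX by auto
      then show ?thesis
        by (simp add: A_def k.kernel_op_lincomb[OF M int[OF u] int[OF v]] algebra_simps)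
    qed
    show "kernel_op M k' (\<lambda>x. s * u x + t * v x) x = s * kernel_op M k' u x + t * kernel_op M k' v x"
      if "x \<in> space S" for x s t
      using that spX by (intro k'.kernel_op_lincomb[OF M int[OF u] int[OF v]]) auto
  qed
qed

section \<open>Surface measure of a Lipschitz boundary\<close>

text \<open>
  Balls of radius \<open>\<eta> / 2\<close> about \<open>\<eta>\<close>-separated points are disjoint; compare volumes.
\<close>

lemma card_separated_le:
  fixes P :: "'a::euclidean_space set"
  assumes fin: "finite P" and P: "P \<subseteq> cball z \<rho>" and \<eta>: "\<eta> > 0" and \<rho>: "\<rho> \<ge> 0"
    and sep: "\<And>p q. p \<in> P \<Longrightarrow> q \<in> P \<Longrightarrow> p \<noteq> q \<Longrightarrow> \<eta> \<le> dist p q"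
  shows "real (card P) * (\<eta> / 2) ^ DIM('a) \<le> (\<rho> + \<eta> / 2) ^ DIM('a)"
proof -
  let ?v = "unit_ball_vol (real DIM('a))"
  have disj: "disjoint_family_on (\<lambda>p. ball p (\<eta> / 2)) P"
    unfolding disjoint_family_on_def
  proof (intro ballI impI, rule ccontr)
    fix p q assume pq: "p \<in> P" "q \<in> P" "p \<noteq> q" and "ball p (\<eta> / 2) \<inter> ball q (\<eta> / 2) \<noteq> {}"
    then obtain y where "dist p y < \<eta> / 2" "dist q y < \<eta> / 2" by auto
    then have "dist p q < \<eta>" using dist_triangle_half_l[of p y \<eta> q] by (simp add: dist_commute)
    with sep[OF pq] show False by simp
  qed
  have "(\<Union>p\<in>P. ball p (\<eta> / 2)) \<subseteq> ball z (\<rho> + \<eta> / 2)"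
  proof safe
    fix p y assume p: "p \<in> P" and y: "y \<in> ball p (\<eta> / 2)"
    have "dist z p \<le> \<rho>" using P p by auto
    then show "y \<in> ball z (\<rho> + \<eta> / 2)" using y dist_triangle[of z y p] by simp
  qed
  then have "measure lborel (\<Union>p\<in>P. ball p (\<eta> / 2)) \<le> measure lborel (ball z (\<rho> + \<eta> / 2))"
    by (intro measure_mono_fmeasurable)
      (use fin emeasure_lborel_ball_finite[of z "\<rho> + \<eta> / 2"] in
        \<open>auto simp: fmeasurable_def intro!: sets.finite_UN\<close>)
  moreover have "measure lborel (\<Union>p\<in>P. ball p (\<eta> / 2)) = (\<Sum>p\<in>P. measure lborel (ball p (\<eta> / 2)))"
    by (rule measure_finite_Union[OF fin _ disj])
      (use emeasure_lborel_ball_finite in \<open>auto simp: less_top[symmetric]\<close>)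
  ultimately have "real (card P) * (?v * (\<eta> / 2) ^ DIM('a)) \<le> ?v * (\<rho> + \<eta> / 2) ^ DIM('a)"
    using \<eta> \<rho> by (simp add: content_ball)
  then have "?v * (real (card P) * (\<eta> / 2) ^ DIM('a)) \<le> ?v * (\<rho> + \<eta> / 2) ^ DIM('a)"
    by (simp only: mult.left_commute)
  then show ?thesis by (rule mult_left_le_imp_le) simp
qed

text \<open>
  Think of \<open>h y\<close> as the height of \<open>y\<close> above a Lipschitz graph in direction \<open>e\<close>, and of \<open>A\<close> as a
  piece of the graph.  Comparing volumes bounds the number of \<open>\<eta>\<close>-separated points in a ball
  only by a multiple of \<open>\<eta>\<close> to the power \<open>-d\<close>.  Points on a graph are fewer by a factor \<open>\<eta>\<close>, since their
  translates by multiples of \<open>c \<eta> e\<close> remain separated: translates by different multiples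
  differ by at least \<open>c \<eta>\<close> in height, and the height is \<open>c\<close>-Lipschitz.
\<close>

lemma card_separated_zero_height_le:
  fixes A :: "'a::euclidean_space set" and h :: "'a \<Rightarrow> real"
  assumes A: "A \<subseteq> ball x r" and r: "r > 0" and c: "c > 0" and e: "norm e = 1"
    and h_lip: "\<And>y z. \<bar>h y - h z\<bar> \<le> c * dist y z"
    and h_shift: "\<And>y t. h (y + t *\<^sub>R e) = h y + t"
    and h_zero: "\<And>y. y \<in> A \<Longrightarrow> h y = 0"
    and \<eta>: "0 < \<eta>" "\<eta> \<le> 1"
    and P: "finite P" "P \<subseteq> A" and sep: "\<And>p q. p \<in> P \<Longrightarrow> q \<in> P \<Longrightarrow> p \<noteq> q \<Longrightarrow> \<eta> \<le> dist p q"
  shows "real (card P) * \<eta> ^ (DIM('a) - 1) \<le> c * (2 * (r + 2)) ^ DIM('a)"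
proof -
  (* the number of translates that move a point by at most 1 *)
  define m where "m = nat \<lceil>1 / (c * \<eta>)\<rceil>"
  have c\<eta>: "c * \<eta> > 0" using c \<eta> by simp
  have m_ge: "1 / (c * \<eta>) \<le> real m" unfolding m_def by linarith
  have k_le: "real k * (c * \<eta>) \<le> 1" if "k < m" for k
  proof -
    have "real k < 1 / (c * \<eta>)" using that c\<eta> unfolding m_def by (metis less_ceiling_iff of_int_of_nat_eq zless_nat_eq_int_zless)
    then show ?thesis using c\<eta> by (simp add: field_simps)
  qed
  define \<tau> where "\<tau> = (\<lambda>(p, k::nat). p + (real k * (c * \<eta>)) *\<^sub>R e)"
  have \<tau>_sep: "\<eta> \<le> dist (\<tau> a) (\<tau> b)" if a: "a \<in> P \<times> {..<m}" and b: "b \<in> P \<times> {..<m}" and ab: "a \<noteq> b" for a b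
  proof -
    obtain p k where a': "a = (p, k)" by (cases a)
    obtain q l where b': "b = (q, l)" by (cases b)
    have pq: "p \<in> P" "q \<in> P" using a b a' b' by auto
    show ?thesis
    proof (cases "k = l")
      case True
      then have "p \<noteq> q" using ab a' b' by auto
      then show ?thesis using sep[OF pq] True by (simp add: \<tau>_def a' b' dist_norm)
    next
      case False
      have "h (\<tau> a) = real k * (c * \<eta>)" "h (\<tau> b) = real l * (c * \<eta>)"
        using pq P h_zero h_shift by (auto simp: \<tau>_def a' b')
      then have eq: "\<bar>h (\<tau> a) - h (\<tau> b)\<bar> = \<bar>real k - real l\<bar> * (c * \<eta>)"
        using c \<eta> by (simp add: abs_mult flip: left_diff_distrib)
      have "1 \<le> \<bar>real k - real l\<bar>" using False by linarith
      then have "1 * (c * \<eta>) \<le> \<bar>h (\<tau> a) - h (\<tau> b)\<bar>"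
        unfolding eq using c\<eta> by (intro mult_right_mono) auto
      also have "\<dots> \<le> c * dist (\<tau> a) (\<tau> b)" by (rule h_lip)
      finally show ?thesis using c by simp
    qed
  qed
  have inj: "inj_on \<tau> (P \<times> {..<m})"
  proof (rule inj_onI, rule ccontr)
    fix a b assume "a \<in> P \<times> {..<m}" "b \<in> P \<times> {..<m}" "\<tau> a = \<tau> b" "a \<noteq> b"
    then show False using \<tau>_sep[of a b] \<eta> by simp
  qed
  have "\<tau> ` (P \<times> {..<m}) \<subseteq> cball x (r + 1)"
  proof safe
    fix p k assume p: "p \<in> P" and k: "k < m"
    have "dist x (\<tau> (p, k)) \<le> dist x p + dist p (\<tau> (p, k))" by (rule dist_triangle)
    also have "dist p (\<tau> (p, k)) = real k * (c * \<eta>)" using c\<eta> by (simp add: \<tau>_def dist_norm e)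
    also have "\<dots> \<le> 1" using k by (rule k_le)
    also have "dist x p \<le> r" using p P A by (auto simp: less_imp_le)
    finally show "\<tau> (p, k) \<in> cball x (r + 1)" by simp
  qed
  moreover have "\<eta> \<le> dist p q" if "p \<in> \<tau> ` (P \<times> {..<m})" "q \<in> \<tau> ` (P \<times> {..<m})" "p \<noteq> q" for p q
    using that \<tau>_sep by blast
  ultimately have "real (card (\<tau> ` (P \<times> {..<m}))) * (\<eta> / 2) ^ DIM('a) \<le> (r + 1 + \<eta> / 2) ^ DIM('a)"
    by (intro card_separated_le) (use P r \<eta> in auto)
  also have "\<dots> \<le> (r + 2) ^ DIM('a)" using r \<eta> by (intro power_mono) auto
  finally have "(real (card P) * real m) * (\<eta> / 2) ^ DIM('a) \<le> (r + 2) ^ DIM('a)"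
    by (simp add: card_image[OF inj] card_cartesian_product)
  then have "2 ^ DIM('a) * ((real (card P) * real m) * (\<eta> / 2) ^ DIM('a)) \<le> 2 ^ DIM('a) * (r + 2) ^ DIM('a)"
    by (rule mult_left_mono) simp
  also have "2 ^ DIM('a) * (r + 2) ^ DIM('a) = (2 * (r + 2)) ^ DIM('a)"
    by (simp only: power_mult_distrib)
  finally have 1: "(real (card P) * real m) * \<eta> ^ DIM('a) \<le> (2 * (r + 2)) ^ DIM('a)"
    by (simp add: power_divide)
  have "\<eta> ^ DIM('a) = \<eta> * \<eta> ^ (DIM('a) - 1)" by (simp add: power_eq_if)
  then have "real (card P) * \<eta> ^ (DIM('a) - 1) = c * ((real (card P) * (1 / (c * \<eta>))) * \<eta> ^ DIM('a))"
    using c \<eta> by simp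
  also have "\<dots> \<le> c * ((real (card P) * real m) * \<eta> ^ DIM('a))"
    using c \<eta> m_ge by (intro mult_left_mono mult_right_mono) auto
  also have "\<dots> \<le> c * (2 * (r + 2)) ^ DIM('a)" using 1 c by (intro mult_left_mono) auto
  finally show ?thesis .
qed

text \<open>
  A maximal \<open>\<eta>\<close>-separated subset is finite by the bound above, and the balls of radius \<open>\<eta>\<close> about
  its points cover \<open>A\<close>.  Their total \<open>(d - 1)\<close>-dimensional weight is bounded independently of \<open>\<eta>\<close>.
\<close>

lemma finite_hausdorff_outer_zero_height:
  fixes A :: "'a::euclidean_space set" and h :: "'a \<Rightarrow> real"
  assumes A: "A \<subseteq> ball x r" and r: "r > 0" and c: "c > 0" and e: "norm e = 1"
    and h_lip: "\<And>y z. \<bar>h y - h z\<bar> \<le> c * dist y z"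
    and h_shift: "\<And>y t. h (y + t *\<^sub>R e) = h y + t"
    and h_zero: "\<And>y. y \<in> A \<Longrightarrow> h y = 0"
  shows "hausdorff_outer (DIM('a) - 1) A < \<infinity>"
proof -
  let ?s = "DIM('a) - 1"
  let ?v = "unit_ball_vol (real ?s)"
  define C where "C = c * (2 * (r + 2)) ^ DIM('a)"
  have "hausdorff_content ?s \<epsilon> A \<le> ennreal (?v * C)" if \<epsilon>: "\<epsilon> > 0" for \<epsilon>
  proof -
    define \<eta> where "\<eta> = min (\<epsilon> / 2) 1"
    have \<eta>: "0 < \<eta>" "\<eta> \<le> 1" "2 * \<eta> \<le> \<epsilon>" using \<epsilon> by (auto simp: \<eta>_def)
    define ok where "ok P \<longleftrightarrow> finite P \<and> P \<subseteq> A \<and> (\<forall>p\<in>P. \<forall>q\<in>P. p \<noteq> q \<longrightarrow> \<eta> \<le> dist p q)" for P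
    have card: "real (card P) * \<eta> ^ ?s \<le> C" if "ok P" for P
      unfolding C_def
      by (rule card_separated_zero_height_le[OF A r c e h_lip h_shift h_zero \<eta>(1,2)])
        (use that in \<open>auto simp: ok_def\<close>)
    have "\<exists>P. ok P \<and> (\<forall>Q. ok Q \<longrightarrow> card Q \<le> card P)"
    proof (rule ex_has_greatest_nat[where k = "{}" and b = "nat \<lceil>C / \<eta> ^ ?s\<rceil> + 1"])
      show "\<forall>P. ok P \<longrightarrow> card P < nat \<lceil>C / \<eta> ^ ?s\<rceil> + 1"
      proof (intro allI impI)
        fix P assume "ok P"
        then have "real (card P) \<le> C / \<eta> ^ ?s" using card[of P] \<eta> by (simp add: pos_le_divide_eq)
        then show "card P < nat \<lceil>C / \<eta> ^ ?s\<rceil> + 1" by linarith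
      qed
    qed (simp add: ok_def)
    then obtain P where P: "ok P" and max: "\<And>Q. ok Q \<Longrightarrow> card Q \<le> card P" by blast
    have fin: "finite P" using P by (simp add: ok_def)
    have cover: "\<exists>p\<in>P. dist p y < \<eta>" if y: "y \<in> A" for y
    proof (rule ccontr)
      assume no: "\<not> (\<exists>p\<in>P. dist p y < \<eta>)"
      then have "y \<notin> P" using \<eta> by force
      moreover have "ok (insert y P)"
        using P y no by (auto simp: ok_def dist_commute not_less)
      ultimately show False using max[of "insert y P"] fin by simp
    qed
    obtain p where p: "bij_betw p {0..<card P} P"
      using ex_bij_betw_nat_finite[OF fin] by blast
    define D where "D i = (if i < card P then cball (p i) \<eta> else {})" for i
    have "hausdorff_content ?s \<epsilon> A \<le> (\<Sum>i. hausdorff_weight ?s (D i))"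
    proof (rule hausdorff_content_le)
      show "A \<subseteq> (\<Union>i. D i)"
      proof
        fix y assume "y \<in> A"
        then obtain q where "q \<in> P" "dist q y < \<eta>" using cover by blast
        moreover obtain i where "i < card P" "q = p i"
          using p \<open>q \<in> P\<close> by (metis atLeastLessThan_iff bij_betw_imp_surj_on imageE)
        ultimately have "y \<in> D i" by (simp add: D_def)
        then show "y \<in> (\<Union>i. D i)" by blast
      qed
    qed (use \<eta> \<epsilon> in \<open>auto simp: D_def\<close>)
    also have "\<dots> = (\<Sum>i<card P. hausdorff_weight ?s (D i))"
      by (rule suminf_finite) (auto simp: D_def)
    also have "\<dots> = (\<Sum>i<card P. ennreal (?v * \<eta> ^ ?s))"
      using \<eta> by (intro sum.cong) (auto simp: D_def hausdorff_weight_def)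
    also have "\<dots> = ennreal (?v * (real (card P) * \<eta> ^ ?s))"
      using \<eta> by (simp add: ennreal_of_nat_eq_real_of_nat mult_ac flip: ennreal_mult)
    also have "\<dots> \<le> ennreal (?v * C)"
      by (intro ennreal_leI mult_left_mono card P) simp
    finally show ?thesis .
  qed
  then have "hausdorff_outer ?s A \<le> ennreal (?v * C)"
    unfolding hausdorff_outer_def by (intro SUP_least) auto
  then show ?thesis by (simp add: order_le_less_trans)
qed

lemma drop_along_add_scale: "norm e = 1 \<Longrightarrow> drop_along e (y + t *\<^sub>R e) = drop_along e y"
  by (simp add: drop_along_def inner_add_left norm_eq_1 algebra_simps)

lemma drop_along_inner: "norm e = 1 \<Longrightarrow> drop_along e y \<bullet> e = 0"
  by (simp add: drop_along_def inner_diff_left norm_eq_1)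

lemma dist_drop_along_le:
  assumes "norm e = 1"
  shows "dist (drop_along e y) (drop_along e z) \<le> dist y z"
proof -
  have d: "drop_along e y - drop_along e z = (y - z) - ((y - z) \<bullet> e) *\<^sub>R e"
    by (simp add: drop_along_def inner_diff_left algebra_simps)
  have "(norm ((y - z) - ((y - z) \<bullet> e) *\<^sub>R e))\<^sup>2 = (norm (y - z))\<^sup>2 - ((y - z) \<bullet> e)\<^sup>2"
    using assms unfolding power2_norm_eq_inner norm_eq_1
    by (simp add: inner_diff_left inner_diff_right inner_commute power2_eq_square algebra_simps)
  also have "\<dots> \<le> (norm (y - z))\<^sup>2" by simp
  finally show ?thesis unfolding dist_norm d by (rule power2_le_imp_le) simp
qed

text \<open>
  In a graph chart the height above the graph is negative exactly on \<open>\<Omega>\<close>.  By continuity it vanishes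
  on the boundary, so the estimate for graphs applies.
\<close>

lemma finite_hausdorff_outer_frontier_ball:
  fixes \<Omega> :: "'a::euclidean_space set"
  assumes "open \<Omega>" and g: "below_graph \<Omega> x r e \<gamma>"
  shows "hausdorff_outer (DIM('a) - 1) (frontier \<Omega> \<inter> ball x r) < \<infinity>"
proof -
  have r: "r > 0" and e: "norm e = 1" using g by (auto simp: below_graph_def)
  have \<Omega>: "y \<in> \<Omega> \<longleftrightarrow> y \<bullet> e < \<gamma> (drop_along e y)" if "y \<in> ball x r" for y
    using g that unfolding below_graph_def by blast
  obtain L where lip: "L-lipschitz_on {z. z \<bullet> e = 0} \<gamma>" using g by (auto simp: below_graph_def)
  then have L: "L \<ge> 0" by (rule lipschitz_on_nonneg)
  define h where "h y = y \<bullet> e - \<gamma> (drop_along e y)" for y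
  have h_lip: "\<bar>h y - h z\<bar> \<le> (1 + L) * dist y z" for y z
  proof -
    have "\<bar>\<gamma> (drop_along e y) - \<gamma> (drop_along e z)\<bar> \<le> L * dist (drop_along e y) (drop_along e z)"
      using lipschitz_onD[OF lip, of "drop_along e y" "drop_along e z"] drop_along_inner[OF e]
      by (simp add: dist_real_def)
    also have "\<dots> \<le> L * dist y z" by (intro mult_left_mono dist_drop_along_le e L)
    finally have 1: "\<bar>\<gamma> (drop_along e y) - \<gamma> (drop_along e z)\<bar> \<le> L * dist y z" .
    have "\<bar>y \<bullet> e - z \<bullet> e\<bar> \<le> dist y z"
      using Cauchy_Schwarz_ineq2[of "y - z" e] e by (simp add: inner_diff_left dist_norm)
    with 1 show ?thesis unfolding h_def distrib_right by linarith
  qed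
  have h_zero: "h y = 0" if y: "y \<in> frontier \<Omega> \<inter> ball x r" for y
  proof (rule ccontr)
    assume "h y \<noteq> 0"
    have "y \<notin> \<Omega>" using y \<open>open \<Omega>\<close> by (simp add: frontier_def interior_open)
    then have "h y > 0" using \<Omega>[of y] y \<open>h y \<noteq> 0\<close> by (auto simp: h_def)
    have "y \<in> closure \<Omega>" using y by (simp add: frontier_def)
    define d where "d = min (h y / (1 + L)) (r - dist x y)"
    have "d > 0" using \<open>h y > 0\<close> L y by (simp add: d_def)
    then obtain z where z: "z \<in> \<Omega>" "dist z y < d"
      using \<open>y \<in> closure \<Omega>\<close> unfolding closure_approachable by blast
    have "dist x z < r" using dist_triangle[of x z y] z by (simp add: d_def dist_commute)
    then have "h z < 0" using \<Omega>[of z] z by (simp add: h_def)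
    moreover have "(1 + L) * dist z y < h y" using z L by (simp add: d_def field_simps)
    ultimately show False using h_lip[of y z] by (simp add: dist_commute)
  qed
  show ?thesis
    by (rule finite_hausdorff_outer_zero_height[OF _ r _ e h_lip, of _ x])
      (use L h_zero in \<open>auto simp: h_def drop_along_add_scale e inner_add_left norm_eq_1[THEN iffD1, OF e]\<close>)
qed

lemma finite_surface_measure:
  fixes \<Omega> :: "'a::euclidean_space set"
  assumes "bounded_lipschitz_domain \<Omega>"
  shows "finite_measure (surface_on \<Omega>)"
proof -
  let ?H = "hausdorff_measure (DIM('a) - 1) :: 'a measure"
  have op: "open \<Omega>" and bd: "bounded \<Omega>" using assms by (auto simp: bounded_lipschitz_domain_def)
  have comp: "compact (frontier \<Omega>)" using bd by (rule compact_frontier_bounded)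
  have "\<exists>r. r > 0 \<and> hausdorff_outer (DIM('a) - 1) (frontier \<Omega> \<inter> ball x r) < \<infinity>" if "x \<in> frontier \<Omega>" for x
    using assms that finite_hausdorff_outer_frontier_ball[OF op]
    unfolding bounded_lipschitz_domain_def by (metis below_graph_def)
  then obtain r where r: "\<And>x. x \<in> frontier \<Omega> \<Longrightarrow> r x > 0"
    "\<And>x. x \<in> frontier \<Omega> \<Longrightarrow> hausdorff_outer (DIM('a) - 1) (frontier \<Omega> \<inter> ball x (r x)) < \<infinity>"
    by metis
  obtain T where T: "T \<subseteq> frontier \<Omega>" "finite T" "frontier \<Omega> \<subseteq> (\<Union>x\<in>T. ball x (r x))"
    using compactE_image[OF comp, of "frontier \<Omega>" "\<lambda>x. ball x (r x)"] r(1) by force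
  have sets: "frontier \<Omega> \<inter> ball x s \<in> sets borel" for x s
    by (intro sets.Int) (simp_all add: borel_closed)
  have "emeasure ?H (frontier \<Omega>) \<le> emeasure ?H (\<Union>x\<in>T. frontier \<Omega> \<inter> ball x (r x))"
    by (rule emeasure_mono) (use T sets in \<open>auto intro!: sets.finite_UN\<close>)
  also have "\<dots> \<le> (\<Sum>x\<in>T. emeasure ?H (frontier \<Omega> \<inter> ball x (r x)))"
    by (rule emeasure_subadditive_finite) (use T sets in auto)
  also have "\<dots> < \<infinity>"
    using r T sets by (auto simp: emeasure_hausdorff_measure)
  finally have "emeasure ?H (frontier \<Omega>) < \<infinity>" .
  then show ?thesis
    unfolding surface_on_def
    by (intro finite_measureI) (simp add: space_restrict_space emeasure_restrict_space borel_closed)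
qed

text \<open>
  Fix a coordinate direction \<open>b\<close> and a ball inside \<open>\<Omega>\<close>.  Every line in direction \<open>b\<close> through this
  ball leaves the bounded set \<open>\<Omega>\<close> and so meets the boundary.  Given a cover of the boundary by
  sets of diameter \<open>D\<^sub>i\<close>, the slabs of height one in direction \<open>b\<close> over the cubes of side \<open>2 D\<^sub>i\<close> in the
  remaining coordinates cover a fixed ball \<open>B\<close>.  Their volume is a fixed multiple \<open>\<kappa>\<close> of the weight of
  the cover, which is thus bounded below.  The thickening replaces Lebesgue measure on the
  hyperplane by Lebesgue measure on the whole space.
\<close>

lemma hausdorff_outer_frontier_pos:
  fixes \<Omega> :: "'a::euclidean_space set"
  assumes op: "open \<Omega>" and bd: "bounded \<Omega>" and ne: "\<Omega> \<noteq> {}"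
  shows "hausdorff_outer (DIM('a) - 1) (frontier \<Omega>) > 0"
proof -
  let ?s = "DIM('a) - 1"
  define \<kappa> where "\<kappa> = 4 ^ ?s / unit_ball_vol (real ?s)"
  have \<kappa>: "\<kappa> > 0" by (simp add: \<kappa>_def)
  obtain b :: 'a where b: "b \<in> Basis" using nonempty_Basis by blast
  have nb: "norm b = 1" using b by simp
  obtain z \<rho> where z: "\<rho> > 0" "ball z \<rho> \<subseteq> \<Omega>" using op ne by (metis all_not_in_conv open_contains_ball)
  define B where "B = ball (drop_along b z + (1/2) *\<^sub>R b) (min \<rho> (1/2))"
  define \<beta> where "\<beta> = measure lborel B"
  have \<beta>: "\<beta> > 0" "emeasure lborel B = ennreal \<beta>"
    using z(1) emeasure_lborel_ball_finite[of "drop_along b z + (1/2) *\<^sub>R b" "min \<rho> (1/2)"]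
    unfolding \<beta>_def B_def by (auto simp: content_ball_pos emeasure_eq_ennreal_measure)
  have B_slab: "0 < y \<bullet> b \<and> y \<bullet> b < 1 \<and> dist (drop_along b z) (drop_along b y) < \<rho>" if y: "y \<in> B" for y
  proof -
    let ?q = "drop_along b z + (1/2) *\<^sub>R b"
    have q: "?q \<bullet> b = 1/2" "drop_along b ?q = drop_along b z"
      using drop_along_inner[OF nb, of z] drop_along_add_scale[OF nb, of "drop_along b z"] nb
      by (auto simp: inner_add_left norm_eq_1[THEN iffD1] drop_along_def[of b "drop_along b z"])
    have d: "dist ?q y < \<rho>" "dist ?q y < 1/2" using y by (simp_all add: B_def)
    have "\<bar>(?q - y) \<bullet> b\<bar> \<le> dist ?q y"
      using Cauchy_Schwarz_ineq2[of "?q - y" b] nb by (simp add: dist_norm)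
    moreover have "(?q - y) \<bullet> b = 1/2 - y \<bullet> b" using q by (simp add: inner_diff_left)
    ultimately have "0 < y \<bullet> b \<and> y \<bullet> b < 1" using d by linarith
    moreover have "dist (drop_along b z) (drop_along b y) < \<rho>"
      using dist_drop_along_le[OF nb, of ?q y] d q by simp
    ultimately show ?thesis by blast
  qed
  have hit: "\<exists>f\<in>frontier \<Omega>. drop_along b f = drop_along b y" if y: "y \<in> B" for y
  proof -
    define y' where "y' = drop_along b y + (z \<bullet> b) *\<^sub>R b"
    define l where "l = range (\<lambda>t::real. y' + t *\<^sub>R b)"
    have "z = drop_along b z + (z \<bullet> b) *\<^sub>R b" by (simp add: drop_along_def)
    then have "dist z y' = dist (drop_along b z) (drop_along b y)"
      unfolding y'_def by (metis dist_add_cancel2)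
    then have "y' \<in> \<Omega>" using B_slab[OF y] z by auto
    moreover have "y' \<in> l" unfolding l_def by (rule range_eqI[of _ _ 0]) simp
    ultimately have "l \<inter> \<Omega> \<noteq> {}" by blast
    moreover have "l - \<Omega> \<noteq> {}"
    proof
      assume "l - \<Omega> = {}"
      then have "bounded l" using bd bounded_subset by blast
      then obtain R where R: "\<And>t. norm (y' + t *\<^sub>R b) \<le> R" unfolding bounded_iff l_def by auto
      have "norm ((R + norm y' + 1) *\<^sub>R b) \<le> norm (y' + (R + norm y' + 1) *\<^sub>R b) + norm y'"
        using norm_triangle_ineq4[of "y' + (R + norm y' + 1) *\<^sub>R b" y'] by simp
      moreover have "R \<ge> 0" using order_trans[OF norm_ge_zero R[of 0]] .
      ultimately show False using R[of "R + norm y' + 1"] nb by simp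
    qed
    moreover have "connected l"
      unfolding l_def by (intro connected_continuous_image continuous_intros) simp
    ultimately have "l \<inter> frontier \<Omega> \<noteq> {}" by (rule connected_Int_frontier[rotated])
    then obtain t where "y' + t *\<^sub>R b \<in> frontier \<Omega>" by (auto simp: l_def)
    moreover have "drop_along b (y' + t *\<^sub>R b) = drop_along b y"
    proof -
      have "drop_along b (drop_along b y) = drop_along b y"
        using drop_along_inner[OF nb, of y] by (simp add: drop_along_def[of b "drop_along b y"])
      then show ?thesis by (simp add: y'_def drop_along_add_scale nb)
    qed
    ultimately show ?thesis by blast
  qed
  have lower: "ennreal \<beta> \<le> ennreal \<kappa> * (\<Sum>i. hausdorff_weight ?s (C i))"
    if C: "C \<in> hausdorff_covers 1 (frontier \<Omega>)" for C
  proof -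
    have cov: "frontier \<Omega> \<subseteq> (\<Union>i. C i)" and Cb: "\<And>i. bounded (C i)"
      using C by (auto simp: hausdorff_covers_def)
    define p where "p i = (SOME p. p \<in> C i)" for i
    define D where "D i = diameter (C i)" for i
    have D: "D i \<ge> 0" for i unfolding D_def using Cb by (rule diameter_ge_0)
    have pC: "p i \<in> C i" if "C i \<noteq> {}" for i unfolding p_def using that by (simp add: some_in_eq)
    define lo where "lo i = (\<Sum>j\<in>Basis. (if j = b then 0 else p i \<bullet> j - D i) *\<^sub>R j)" for i
    define hi where "hi i = (\<Sum>j\<in>Basis. (if j = b then 1 else p i \<bullet> j + D i) *\<^sub>R j)" for i
    have lo: "lo i \<bullet> j = (if j = b then 0 else p i \<bullet> j - D i)"
      and hi: "hi i \<bullet> j = (if j = b then 1 else p i \<bullet> j + D i)" if "j \<in> Basis" for i j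
      using that by (simp_all add: lo_def hi_def)
    (* in dimension one every non-empty set has weight one, whatever its diameter, and its slab has volume one; empty sets have weight zero *)
    define G where "G i = (if C i = {} then {} else cbox (lo i) (hi i))" for i
    have G: "emeasure lborel (G i) = ennreal \<kappa> * hausdorff_weight ?s (C i)" for i
    proof (cases "C i = {}")
      case False
      have "emeasure lborel (G i) = ennreal (\<Prod>j\<in>Basis. (hi i - lo i) \<bullet> j)"
        using False D[of i] by (simp add: G_def emeasure_lborel_cbox lo hi)
      also have "(\<Prod>j\<in>Basis. (hi i - lo i) \<bullet> j) = (\<Prod>j\<in>Basis - {b}. (hi i - lo i) \<bullet> j)"
        using b by (subst prod.remove[OF finite_Basis b]) (simp add: inner_diff_left lo hi)
      also have "\<dots> = (\<Prod>j\<in>Basis - {b}. 2 * D i)"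
        by (intro prod.cong) (auto simp: inner_diff_left lo hi)
      also have "\<dots> = (2 * D i) ^ ?s" using b by simp
      also have "\<dots> = \<kappa> * (unit_ball_vol (real ?s) * (D i / 2) ^ ?s)"
      proof -
        have "4 ^ ?s / v * (v * z) = 4 ^ ?s * z" if "v > 0" for v z :: real
          using that by simp
        from this[OF unit_ball_vol_pos[OF of_nat_0_le_iff]]
        have "\<kappa> * (unit_ball_vol (real ?s) * (D i / 2) ^ ?s) = 4 ^ ?s * (D i / 2) ^ ?s"
          unfolding \<kappa>_def .
        also have "\<dots> = (4 * (D i / 2)) ^ ?s" by (simp only: power_mult_distrib)
        finally show ?thesis by simp
      qed
      also have "ennreal \<dots> = ennreal \<kappa> * hausdorff_weight ?s (C i)"
        using False \<kappa> D[of i] by (simp add: hausdorff_weight_def D_def ennreal_mult)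
      finally show ?thesis .
    qed (simp add: G_def)
    have "B \<subseteq> (\<Union>i. G i)"
    proof
      fix y assume y: "y \<in> B"
      then obtain f where f: "f \<in> frontier \<Omega>" "drop_along b f = drop_along b y" using hit by blast
      then obtain i where i: "f \<in> C i" using cov by blast
      have fj: "f \<bullet> j = y \<bullet> j" if "j \<in> Basis" "j \<noteq> b" for j
      proof -
        have "drop_along b w \<bullet> j = w \<bullet> j" for w
          using that b by (simp add: drop_along_def inner_diff_left inner_Basis)
        then show ?thesis using f(2) by metis
      qed
      have "y \<in> cbox (lo i) (hi i)"
        unfolding mem_box
      proof
        fix j :: 'a assume j: "j \<in> Basis"
        show "lo i \<bullet> j \<le> y \<bullet> j \<and> y \<bullet> j \<le> hi i \<bullet> j"
        proof (cases "j = b")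
          case True
          then show ?thesis using B_slab[OF y] j by (simp add: lo hi less_imp_le)
        next
          case False
          have "\<bar>(f - p i) \<bullet> j\<bar> \<le> norm (f - p i)" using j by (rule Basis_le_norm)
          also have "\<dots> \<le> D i"
          proof -
            have "C i \<noteq> {}" using i by auto
            then show ?thesis
              unfolding D_def using diameter_bounded_bound[OF Cb i pC] by (simp add: dist_norm)
          qed
          finally show ?thesis
            using False j fj[OF j False] by (simp add: lo hi inner_diff_left abs_le_iff)
        qed
      qed
      then have "y \<in> G i" using i by (auto simp: G_def)
      then show "y \<in> (\<Union>i. G i)" by blast
    qed
    then have "emeasure lborel B \<le> emeasure lborel (\<Union>i. G i)"
      by (intro emeasure_mono) (auto simp: G_def)
    also have "\<dots> \<le> (\<Sum>i. emeasure lborel (G i))"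
      by (rule emeasure_subadditive_countably) (auto simp: G_def)
    also have "\<dots> = ennreal \<kappa> * (\<Sum>i. hausdorff_weight ?s (C i))"
      by (simp add: G)
    finally show ?thesis using \<beta> by simp
  qed
  show ?thesis
  proof (rule ccontr)
    assume "\<not> ?thesis"
    then have "hausdorff_content ?s 1 (frontier \<Omega>) = 0"
      using hausdorff_content_le_outer[of 1 ?s "frontier \<Omega>"] by simp
    moreover have "0 < ennreal (\<beta> / (2 * \<kappa>))" using \<beta> \<kappa> by simp
    ultimately have "hausdorff_content ?s 1 (frontier \<Omega>) < ennreal (\<beta> / (2 * \<kappa>))" by simp
    then obtain C where C: "C \<in> hausdorff_covers 1 (frontier \<Omega>)"
      and lt: "(\<Sum>i. hausdorff_weight ?s (C i)) < ennreal (\<beta> / (2 * \<kappa>))"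
      unfolding hausdorff_content_def INF_less_iff by blast
    have "ennreal \<beta> \<le> ennreal \<kappa> * ennreal (\<beta> / (2 * \<kappa>))"
      using lower[OF C] mult_left_mono[OF less_imp_le[OF lt], of "ennreal \<kappa>"] by (rule order_trans) simp
    also have "\<dots> = ennreal (\<beta> / 2)" using \<kappa> \<beta> by (simp flip: ennreal_mult)
    finally show False using \<beta> by (simp add: ennreal_le_iff)
  qed
qed

lemma emeasure_surface_pos:
  assumes "bounded_lipschitz_domain \<Omega>"
  shows "emeasure (surface_on \<Omega>) (space (surface_on \<Omega>)) > 0"
  using assms hausdorff_outer_frontier_pos[of \<Omega>]
  by (auto simp: bounded_lipschitz_domain_def surface_on_def space_restrict_space
      emeasure_restrict_space borel_closed emeasure_hausdorff_measure)

section \<open>Weighted means on a connected domain\<close>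

lemma finite_borel_on_volume:
  assumes "open \<Omega>" "bounded \<Omega>"
  shows "finite_borel_on (closure \<Omega>) (volume_on \<Omega>)"
proof -
  have "emeasure lborel \<Omega> < \<infinity>" using emeasure_bounded_finite[OF assms(2)] by simp
  then have "finite_measure (volume_on \<Omega>)"
    unfolding volume_on_def using assms(1)
    by (intro finite_measureI) (simp add: space_restrict_space emeasure_restrict_space)
  moreover have "sets (volume_on \<Omega>) = sets (restrict_space borel \<Omega>)"
    unfolding volume_on_def by (intro sets_restrict_space_cong) simp
  ultimately show ?thesis
    unfolding finite_borel_on_def using closure_subset by blast
qed

lemma space_volume_on: "space (volume_on \<Omega>) = \<Omega>"
  by (simp add: volume_on_def space_restrict_space)

text \<open>
  The set where \<open>h\<close> is positive is open and non-empty, hence not a null set.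
\<close>

lemma integral_volume_pos:
  fixes h :: "'a::euclidean_space \<Rightarrow> real"
  assumes op: "open \<Omega>" and bd: "bounded \<Omega>" and h: "continuous_on (closure \<Omega>) h"
    and nonneg: "\<And>y. y \<in> \<Omega> \<Longrightarrow> 0 \<le> h y" and y: "y \<in> \<Omega>" "h y > 0"
    and int: "integrable (volume_on \<Omega>) h"
  shows "(LINT x|volume_on \<Omega>. h x) > 0"
proof (rule ccontr)
  assume "\<not> ?thesis"
  moreover have "(LINT x|volume_on \<Omega>. h x) \<ge> 0"
    by (rule integral_nonneg_AE, rule AE_I2) (simp add: space_volume_on nonneg)
  ultimately have "(LINT x|volume_on \<Omega>. h x) = 0" by simp
  then have "AE x in volume_on \<Omega>. h x = 0"
    using integral_nonneg_eq_0_iff_AE[OF int AE_I2] nonneg by (simp add: space_volume_on)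
  then have "AE x in lborel. x \<in> \<Omega> \<longrightarrow> h x = 0"
    unfolding volume_on_def using op by (subst (asm) AE_restrict_space_iff) auto
  then have ae: "AE x\<in>{x\<in>\<Omega>. h x > 0} in lebesgue. x \<in> {}"
    by (intro AE_completion) auto
  have "open {x\<in>\<Omega>. h x > 0}"
    using continuous_open_preimage[OF continuous_on_subset[OF h closure_subset] op open_greaterThan[of 0]]
    by (auto simp: Int_def vimage_def)
  from mem_closed_if_AE_lebesgue_open[OF this closed_empty ae, of y] y show False by simp
qed

lemma kernel_op_one_pos:
  assumes op: "open \<Omega>" and bd: "bounded \<Omega>" and k: "compact_kernel (closure \<Omega>) k"
    and nonneg: "\<And>x y. 0 \<le> k x y" and \<rho>: "\<rho> > 0" "\<And>x y. dist x y < \<rho> \<Longrightarrow> 0 < k x y"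
    and x: "x \<in> closure \<Omega>"
  shows "kernel_op (volume_on \<Omega>) k (\<lambda>_. 1) x > 0"
proof -
  interpret compact_kernel "closure \<Omega>" k by fact
  note M = finite_borel_on_volume[OF op bd]
  interpret finite_measure "volume_on \<Omega>" by (rule finite_borel_on_finite_measure[OF M])
  obtain y where y: "y \<in> \<Omega>" "dist y x < \<rho>" using x \<rho>(1) by (auto simp: closure_approachable)
  have "integrable (volume_on \<Omega>) (\<lambda>y. k x y * 1)" by (rule integrable_kernel_mult[OF M _ x]) simp
  then have "(LINT y|volume_on \<Omega>. k x y) > 0"
    using y \<rho>(2)[of x y] nonneg
    by (intro integral_volume_pos[OF op bd continuous_slice[OF x], of y]) (simp_all add: dist_commute)
  then show ?thesis by (simp add: kernel_op_def)
qed

text \<open>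
  Strong maximum principle.  The equation says that \<open>v - v x\<close> has integral zero against the
  non-negative weight \<open>k x\<close>.  If \<open>v\<close> is maximal at \<open>x\<close> the integrand has a sign, so \<open>v = v x\<close>
  wherever the weight is positive, in particular within distance \<open>\<rho>\<close> of \<open>x\<close>.  The radius does not
  depend on \<open>x\<close>, so inside \<open>\<Omega>\<close> attaining the maximum is a locally constant property.  If the
  maximum over the closure is attained on the boundary, it spreads from there into \<open>\<Omega>\<close>.
\<close>

lemma kernel_op_mean_value_constant:
  assumes op: "open \<Omega>" and bd: "bounded \<Omega>" and conn: "connected \<Omega>" and ne: "\<Omega> \<noteq> {}"
    and k: "compact_kernel (closure \<Omega>) k"
    and nonneg: "\<And>x y. 0 \<le> k x y" and \<rho>: "\<rho> > 0" "\<And>x y. dist x y < \<rho> \<Longrightarrow> 0 < k x y"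
    and v: "continuous_on (closure \<Omega>) v"
    and mean: "\<And>x. x \<in> closure \<Omega> \<Longrightarrow>
      kernel_op (volume_on \<Omega>) k (\<lambda>_. 1) x * v x = kernel_op (volume_on \<Omega>) k v x"
  obtains m where "\<And>y. y \<in> \<Omega> \<Longrightarrow> v y = m"
proof -
  interpret compact_kernel "closure \<Omega>" k by fact
  note M = finite_borel_on_volume[OF op bd]
  interpret finite_measure "volume_on \<Omega>" by (rule finite_borel_on_finite_measure[OF M])
  have "closure \<Omega> \<noteq> {}" using ne by simp
  then obtain x0 where x0: "x0 \<in> closure \<Omega>" and max: "\<And>x. x \<in> closure \<Omega> \<Longrightarrow> v x \<le> v x0"
    using continuous_attains_sup[OF compact _ v] by blast
  define m where "m = v x0"
  have v_int: "integrable (volume_on \<Omega>) v"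
  proof -
    obtain B where "\<And>x. x \<in> closure \<Omega> \<Longrightarrow> norm (v x) \<le> B"
      using compact_imp_bounded[OF compact_continuous_image[OF v compact]] unfolding bounded_iff by auto
    then show ?thesis
      using finite_borel_on_measurable[OF M v] finite_borel_on_space[OF M]
      by (intro integrable_const_bound[where B = B] AE_I2) auto
  qed
  have spread: "v y = m" if x: "x \<in> closure \<Omega>" and vx: "v x = m" and y: "y \<in> \<Omega>" "dist x y < \<rho>" for x y
  proof (rule ccontr)
    assume "v y \<noteq> m"
    have le: "v z \<le> m" if "z \<in> \<Omega>" for z using max[of z] that closure_subset by (auto simp: m_def)
    have diff: "k x z * (m * 1 + (-1) * v z) = k x z * (m - v z)" for z by simp
    have "integrable (volume_on \<Omega>) (\<lambda>z. k x z * (m * 1 + (-1) * v z))"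
      by (intro integrable_kernel_mult[OF M _ x] Bochner_Integration.integrable_add
          integrable_mult_right v_int) simp
    then have "(LINT z|volume_on \<Omega>. k x z * (m - v z)) > 0"
      using y \<rho>(2)[OF y(2)] le less_le[of "v y" m] \<open>v y \<noteq> m\<close> nonneg[of x] unfolding diff
      by (intro integral_volume_pos[OF op bd _ _ y(1)] continuous_intros continuous_slice[OF x] v)
        simp_all
    moreover have "kernel_op (volume_on \<Omega>) k (\<lambda>z. m * 1 + (-1) * v z) x =
        m * kernel_op (volume_on \<Omega>) k (\<lambda>_. 1) x + (-1) * kernel_op (volume_on \<Omega>) k v x"
      by (rule kernel_op_lincomb[OF M _ v_int x]) simp
    then have "(LINT z|volume_on \<Omega>. k x z * (m - v z)) =
        m * kernel_op (volume_on \<Omega>) k (\<lambda>_. 1) x + (-1) * kernel_op (volume_on \<Omega>) k v x"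
      by (simp add: kernel_op_def)
    ultimately show False using mean[OF x] vx by (simp add: mult.commute)
  qed
  obtain y0 where y0: "y0 \<in> \<Omega>" "dist y0 x0 < \<rho>" using x0 \<rho>(1) by (auto simp: closure_approachable)
  have y0m: "v y0 = m" by (rule spread[OF x0 _ y0(1)]) (use y0 in \<open>simp_all add: m_def dist_commute\<close>)
  have "v y = m" if y: "y \<in> \<Omega>" for y
  proof -
    have "(v y = m) = (v y0 = m)"
    proof (rule connected_local_const[OF conn y y0(1)], intro ballI)
      fix a assume a: "a \<in> \<Omega>"
      have cl: "z \<in> closure \<Omega>" if "z \<in> \<Omega>" for z using that closure_subset by auto
      show "\<forall>\<^sub>F b in at a within \<Omega>. (v a = m) = (v b = m)"
        unfolding eventually_at
      proof (intro exI conjI ballI impI)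
        show "\<rho> > 0" by fact
        fix b assume b: "b \<in> \<Omega>" and "b \<noteq> a \<and> dist b a < \<rho>"
        then have "dist b a < \<rho>" "dist a b < \<rho>" by (simp_all add: dist_commute)
        then show "(v a = m) = (v b = m)"
          using spread[OF cl[OF a] _ b] spread[OF cl[OF b] _ a] by blast
      qed
    qed
    with y0m show ?thesis by simp
  qed
  then show thesis by (rule that)
qed

section \<open>Scaled kernels\<close>

lemma continuous_kernel_profile: "kernel_profile r k \<Longrightarrow> continuous_on {0..} k"
  unfolding kernel_profile_def by (meson DERIV_continuous_on atLeast_iff)

lemma kernel_profile_zero: "kernel_profile r k \<Longrightarrow> s > r\<^sup>2 / 4 \<Longrightarrow> k s = 0"
proof (rule ccontr)
  assume k: "kernel_profile r k" and s: "s > r\<^sup>2 / 4" "k s \<noteq> 0"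
  have "s \<ge> 0" using s(1) zero_le_power2[of r] by linarith
  then have "s \<in> closure {s. 0 \<le> s \<and> k s \<noteq> 0}"
    using s(2) by (intro subsetD[OF closure_subset]) simp
  then show False using k s by (auto simp: kernel_profile_def)
qed

text \<open>
  The kernel vanishes beyond \<open>r\<^sup>2 / 4\<close>, so the improper integral is an integral over a compact
  interval, which depends continuously on its lower limit.
\<close>

lemma continuous_tail_profile:
  assumes k: "kernel_profile r k"
  shows "continuous_on {0..} (tail_profile k)"
proof -
  define B where "B = r\<^sup>2 / 4"
  have B: "B \<ge> 0" by (simp add: B_def)
  have cont: "continuous_on {s..B} k" if "s \<ge> 0" for s
    using continuous_kernel_profile[OF k] by (rule continuous_on_subset) (use that in auto)
  have eq: "tail_profile k s = integral {min s B..B} k" if s: "s \<ge> 0" for s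
  proof -
    have "tail_profile k s = (LBINT t:{min s B..B}. k t)"
      unfolding tail_profile_def set_lebesgue_integral_def
    proof (rule integral_cong_AE)
      have "continuous_on {s..} k"
        using continuous_kernel_profile[OF k] by (rule continuous_on_subset) (use s in auto)
      then show "(\<lambda>t. indicator {s..} t *\<^sub>R k t) \<in> borel_measurable lborel"
        using borel_measurable_continuous_on_indicator[of _ k] by simp
      have "continuous_on {min s B..B} k" by (rule cont) (use s B in auto)
      then show "(\<lambda>t. indicator {min s B..B} t *\<^sub>R k t) \<in> borel_measurable lborel"
        using borel_measurable_continuous_on_indicator[of _ k] by simp
      show "AE t in lborel. indicator {s..} t *\<^sub>R k t = indicator {min s B..B} t *\<^sub>R k t"
        (* for s > B the second interval is the single point B, where the integrands may differ *)
        using AE_lborel_singleton[of B]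
        by eventually_elim (use kernel_profile_zero[OF k] in \<open>auto simp: B_def indicator_def not_le\<close>)
    qed
    also have "\<dots> = integral {min s B..B} k"
      by (intro set_borel_integral_eq_integral borel_integrable_atLeastAtMost' cont) (use s B in auto)
    finally show ?thesis .
  qed
  have "continuous_on {0..B} (\<lambda>s. integral {s..B} k)"
    by (intro indefinite_integral_continuous_1' integrable_continuous_interval cont) simp
  then have "continuous_on {0..} (\<lambda>s. integral {min s B..B} k)"
    by (rule continuous_on_compose2) (use B in \<open>auto intro!: continuous_intros\<close>)
  then show ?thesis by (rule continuous_on_eq) (simp add: eq)
qed

lemma compact_kernel_scaled:
  fixes X :: "'a::euclidean_space set"
  assumes "compact X" and p: "continuous_on {0..} p" and \<delta>: "\<delta> > 0"
  shows "compact_kernel X (scaled_kernel \<delta> p)"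
proof
  show "continuous_on (X \<times> X) (\<lambda>q. scaled_kernel \<delta> p (fst q) (snd q))"
    unfolding scaled_kernel_def
    by (intro continuous_on_mult continuous_on_const continuous_on_compose2[OF p])
      (use \<delta> in \<open>auto intro!: continuous_intros\<close>)
qed fact

lemma scaled_kernel_nonneg:
  assumes "kernel_profile r k" "\<delta> > 0"
  shows "0 \<le> scaled_kernel \<delta> k x y"
  using assms by (auto simp: scaled_kernel_def kernel_profile_def)

text \<open>
  A decreasing profile that is not identically zero is positive at \<open>0\<close>, hence near \<open>0\<close>.
\<close>

lemma scaled_kernel_pos_near_diagonal:
  assumes k: "kernel_profile r k" and nz: "\<exists>s\<ge>0. k s \<noteq> 0" and \<delta>: "\<delta> > 0"
  obtains \<rho> where "\<rho> > 0" "\<And>x y :: 'a::euclidean_space. dist x y < \<rho> \<Longrightarrow> 0 < scaled_kernel \<delta> k x y"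
proof -
  obtain s where s: "s \<ge> 0" "k s \<noteq> 0" using nz by blast
  then have "0 < k s" using k by (force simp: kernel_profile_def)
  also have "k s \<le> k 0"
    using k s unfolding kernel_profile_def by (auto dest: monotone_onD[of _ _ _ _ 0 s])
  finally have k0: "k 0 > 0" .
  obtain d where d: "d > 0" "\<And>t. t \<ge> 0 \<Longrightarrow> dist t 0 < d \<Longrightarrow> dist (k t) (k 0) < k 0"
    using continuous_kernel_profile[OF k] k0 unfolding continuous_on_iff
    by (metis atLeast_iff order_refl)
  have pos: "k t > 0" if "t \<ge> 0" "t < d" for t
    using d(2)[of t] that by (simp add: dist_real_def abs_less_iff)
  show thesis
  proof (rule that)
    (* solves (dist x y)^2 / (4 \<delta>^2) = d for dist x y *)
    show "2 * \<delta> * sqrt d > 0" using d \<delta> by simp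
    fix x y :: 'a assume "dist x y < 2 * \<delta> * sqrt d"
    then have "(dist x y)\<^sup>2 < (2 * \<delta> * sqrt d)\<^sup>2" by (intro power_strict_mono) auto
    also have "\<dots> = d * (4 * \<delta>\<^sup>2)" using d by (simp add: power_mult_distrib)
    finally have "(norm (x - y))\<^sup>2 / (4 * \<delta>\<^sup>2) < d" using \<delta> by (simp add: dist_norm divide_less_eq)
    then have "k ((norm (x - y))\<^sup>2 / (4 * \<delta>\<^sup>2)) > 0" by (intro pos) auto
    then show "0 < scaled_kernel \<delta> k x y" using \<delta> by (simp add: scaled_kernel_def)
  qed
qed

section \<open>The nonlocal functional\<close>

lemma is_arg_min_cong:
  assumes "\<And>u. P u \<Longrightarrow> F u = G u"
  shows "is_arg_min F P u \<longleftrightarrow> is_arg_min G P u"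
  using assms by (auto simp: is_arg_min_def)

lemma finite_borel_on_surface:
  assumes "bounded_lipschitz_domain \<Omega>"
  shows "finite_borel_on (closure \<Omega>) (surface_on \<Omega>)"
proof -
  have "sets (surface_on \<Omega>) = sets (restrict_space borel (frontier \<Omega>))"
    unfolding surface_on_def by (intro sets_restrict_space_cong) simp
  then show ?thesis
    unfolding finite_borel_on_def using finite_surface_measure[OF assms]
    by (auto simp: frontier_def)
qed

lemma space_surface_on: "space (surface_on \<Omega>) = frontier \<Omega>"
  by (simp add: surface_on_def space_restrict_space)

text \<open>
  The mean value equation makes \<open>v\<close> constant on \<open>\<Omega>\<close>.  The boundary condition, at a single boundary
  point, makes the constant zero; such a point exists because the boundary has positive
  surface measure.
\<close>

lemma nonlocal_operators_injective:
  fixes \<Omega> :: "'a::euclidean_space set"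
  assumes dom: "bounded_lipschitz_domain \<Omega>" and R: "kernel_profile r R" and K: "kernel_profile r' K"
    and R_nz: "\<exists>s\<ge>0. R s \<noteq> 0" and K_nz: "\<exists>s\<ge>0. K s \<noteq> 0" and \<delta>: "\<delta> > 0"
    and v: "continuous_on (closure \<Omega>) v"
    and mean: "\<And>x. x \<in> closure \<Omega> \<Longrightarrow>
      kernel_op (volume_on \<Omega>) (scaled_kernel \<delta> R) (\<lambda>_. 1) x * v x
      = kernel_op (volume_on \<Omega>) (scaled_kernel \<delta> R) v x"
    and boundary: "AE x in surface_on \<Omega>. kernel_op (volume_on \<Omega>) (scaled_kernel \<delta> K) v x = 0"
  shows "AE x in volume_on \<Omega>. v x = 0"
proof -
  have op: "open \<Omega>" and bd: "bounded \<Omega>" and conn: "connected \<Omega>" and ne: "\<Omega> \<noteq> {}"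
    using dom by (auto simp: bounded_lipschitz_domain_def)
  have comp: "compact (closure \<Omega>)" using bd by simp
  note kR = compact_kernel_scaled[OF comp continuous_kernel_profile[OF R] \<delta>]
  note kK = compact_kernel_scaled[OF comp continuous_kernel_profile[OF K] \<delta>]
  obtain \<rho> where \<rho>: "\<rho> > 0" "\<And>x y :: 'a. dist x y < \<rho> \<Longrightarrow> 0 < scaled_kernel \<delta> R x y"
    by (rule scaled_kernel_pos_near_diagonal[OF R R_nz \<delta>, where 'a = 'a]) (rule that)
  obtain \<rho>' where \<rho>': "\<rho>' > 0" "\<And>x y :: 'a. dist x y < \<rho>' \<Longrightarrow> 0 < scaled_kernel \<delta> K x y"
    by (rule scaled_kernel_pos_near_diagonal[OF K K_nz \<delta>, where 'a = 'a]) (rule that)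
  obtain m where m: "\<And>y. y \<in> \<Omega> \<Longrightarrow> v y = m"
    using kernel_op_mean_value_constant[OF op bd conn ne kR scaled_kernel_nonneg[OF R \<delta>] \<rho> v mean] by blast
  have "\<exists>x\<in>frontier \<Omega>. kernel_op (volume_on \<Omega>) (scaled_kernel \<delta> K) v x = 0"
  proof (rule ccontr)
    assume no: "\<not> ?thesis"
    have "AE x in surface_on \<Omega>. x \<notin> space (surface_on \<Omega>)"
      using boundary by eventually_elim (use no in \<open>auto simp: space_surface_on\<close>)
    then have "emeasure (surface_on \<Omega>) {x \<in> space (surface_on \<Omega>). x \<in> space (surface_on \<Omega>)} = 0"
      by (intro emeasure_eq_0_AE) simp
    then show False using emeasure_surface_pos[OF dom] by simp
  qed
  then obtain x where x: "x \<in> frontier \<Omega>" and zero: "kernel_op (volume_on \<Omega>) (scaled_kernel \<delta> K) v x = 0"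
    by blast
  have x_cl: "x \<in> closure \<Omega>" using x unfolding frontier_def by blast
  have "kernel_op (volume_on \<Omega>) (scaled_kernel \<delta> K) v x
      = (LINT y|volume_on \<Omega>. m * (scaled_kernel \<delta> K x y * 1))"
    unfolding kernel_op_def
    by (intro Bochner_Integration.integral_cong) (auto simp: space_volume_on m)
  also have "\<dots> = m * kernel_op (volume_on \<Omega>) (scaled_kernel \<delta> K) (\<lambda>_. 1) x"
    by (simp add: kernel_op_def)
  finally have "m * kernel_op (volume_on \<Omega>) (scaled_kernel \<delta> K) (\<lambda>_. 1) x = 0" using zero by simp
  moreover have "kernel_op (volume_on \<Omega>) (scaled_kernel \<delta> K) (\<lambda>_. 1) x > 0"
    by (rule kernel_op_one_pos[OF op bd kK scaled_kernel_nonneg[OF K \<delta>] \<rho>' x_cl])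
  ultimately have "m = 0" by simp
  then show ?thesis using m by (intro AE_I2) (simp add: space_volume_on)
qed

text \<open>
  Expanding the inner integrals of the functional separates the unknown from the data: with
  \<open>w\<close> the total mass of the kernel, \<open>\<integral> k x y (u x - u y) dy = w x u x - T u x\<close>, and similarly at
  the boundary with \<open>a x\<close> in place of \<open>u x\<close>.  The resulting data \<open>g\<close> and \<open>h\<close> are square integrable since
  kernels and their integrals are bounded.
\<close>

theorem theorem2p3:
  fixes \<Omega> :: "'a::euclidean_space set"
    and K R Rt :: "real \<Rightarrow> real"
    and r\<^sub>K r\<^sub>R r\<^sub>t \<delta> \<xi> :: real
    and f a b :: "'a \<Rightarrow> real"
  assumes "bounded_lipschitz_domain \<Omega>"
    and "r\<^sub>K > 0" and "r\<^sub>R > 0" and "r\<^sub>t > 0"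
    and "kernel_profile r\<^sub>K K" and "kernel_profile r\<^sub>R R" and "kernel_profile r\<^sub>t Rt"
    and K_nonzero: "\<exists>s\<ge>0. K s \<noteq> 0" and R_nonzero: "\<exists>s\<ge>0. R s \<noteq> 0"
    and "f \<in> square_integrable (volume_on \<Omega>)"
    and "H2_boundary_data \<Omega> a b"
    and "\<delta> > 0" and "\<xi> > 0"
  shows "\<exists>u. is_arg_min (nonlocal_functional \<Omega> K R \<delta> \<xi> f a b)
               (\<lambda>v. v \<in> square_integrable (volume_on \<Omega>)) u \<and>
             (\<forall>w. is_arg_min (nonlocal_functional \<Omega> K R \<delta> \<xi> f a b)
                    (\<lambda>v. v \<in> square_integrable (volume_on \<Omega>)) w \<longrightarrow>
                  (AE x in volume_on \<Omega>. w x = u x))"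
proof -
  note dom = \<open>bounded_lipschitz_domain \<Omega>\<close> and K = \<open>kernel_profile r\<^sub>K K\<close> and R = \<open>kernel_profile r\<^sub>R R\<close>
    and f = \<open>f \<in> square_integrable (volume_on \<Omega>)\<close> and \<delta> = \<open>\<delta> > 0\<close> and \<xi> = \<open>\<xi> > 0\<close>
  let ?M = "volume_on \<Omega>" and ?S = "surface_on \<Omega>"
  let ?k = "scaled_kernel \<delta> R :: 'a \<Rightarrow> 'a \<Rightarrow> real" and ?k' = "scaled_kernel \<delta> K :: 'a \<Rightarrow> 'a \<Rightarrow> real"
  let ?l = "scaled_kernel \<delta> (tail_profile R) :: 'a \<Rightarrow> 'a \<Rightarrow> real"
  have op: "open \<Omega>" and bd: "bounded \<Omega>" using dom by (auto simp: bounded_lipschitz_domain_def)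
  have comp: "compact (closure \<Omega>)" using bd by simp
  note kR = compact_kernel_scaled[OF comp continuous_kernel_profile[OF R] \<delta>]
  note kK = compact_kernel_scaled[OF comp continuous_kernel_profile[OF K] \<delta>]
  note kT = compact_kernel_scaled[OF comp continuous_tail_profile[OF R] \<delta>]
  interpret kR: compact_kernel "closure \<Omega>" ?k by (rule kR)
  interpret kK: compact_kernel "closure \<Omega>" ?k' by (rule kK)
  interpret kT: compact_kernel "closure \<Omega>" ?l by (rule kT)
  note M = finite_borel_on_volume[OF op bd] and S = finite_borel_on_surface[OF dom]
  interpret M: finite_measure ?M by (rule finite_borel_on_finite_measure[OF M])
  interpret S: finite_measure ?S by (rule finite_borel_on_finite_measure[OF S])
  have a: "a \<in> square_integrable ?S" and b: "b \<in> square_integrable ?S"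
    using \<open>H2_boundary_data \<Omega> a b\<close>
    by (auto simp: H2_boundary_data_def has_trace_def has_normal_derivative_def)
  have one: "integrable ?M (\<lambda>_. 1 :: real)" by simp
  have inc: "x \<in> closure \<Omega>" if "x \<in> \<Omega> \<or> x \<in> frontier \<Omega>" for x
    using that closure_subset by (auto simp: frontier_def)

  define w where "w = kernel_op ?M ?k (\<lambda>_. 1)"
  define g where "g x = 2 * kernel_op ?S ?l b x" for x
  define h where "h x = kernel_op ?M ?k' (\<lambda>_. 1) x * a x" for x
  have w: "continuous_on (closure \<Omega>) w"
    unfolding w_def by (rule kR.continuous_kernel_op[OF M one])
  obtain \<rho> where \<rho>: "\<rho> > 0" "\<And>x y :: 'a. dist x y < \<rho> \<Longrightarrow> 0 < ?k x y"
    by (rule scaled_kernel_pos_near_diagonal[OF R R_nonzero \<delta>, where 'a = 'a]) (rule that)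
  have w_pos: "w x > 0" if "x \<in> closure \<Omega>" for x
    unfolding w_def by (rule kernel_op_one_pos[OF op bd kR scaled_kernel_nonneg[OF R \<delta>] \<rho> that])
  have g: "g \<in> square_integrable ?M"
    unfolding g_def
    by (intro square_integrable_scale kT.kernel_op_square_integrable[OF S M] S.integrable_square_integrable b)
  have h: "h \<in> square_integrable ?S"
    unfolding h_def
    by (rule S.square_integrable_mult_bounded[OF a,
          where B = "kK.bound * (LINT y|?M. \<bar>1 :: real\<bar>)"])
      (use finite_borel_on_measurable[OF S kK.continuous_kernel_op[OF M one]]
        kK.kernel_op_le[OF M one] in \<open>auto simp: space_surface_on inc\<close>)

  have eq: "nonlocal_functional \<Omega> K R \<delta> \<xi> f a b u =
      (LINT x|?M. (1 / \<delta>\<^sup>2 * (w x * u x - kernel_op ?M ?k u x) - g x)\<^sup>2)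
      - 2 * (LINT x|?M. f x * u x) + 1 / \<xi> * (LINT x|?S. (h x - kernel_op ?M ?k' u x)\<^sup>2)"
    if u: "u \<in> square_integrable ?M" for u
  proof -
    note u_int = M.integrable_square_integrable[OF u]
    have 1: "(LINT y|?M. ?k x y * (u x - u y)) = w x * u x - kernel_op ?M ?k u x" if "x \<in> \<Omega>" for x
      using kR.kernel_op_lincomb[OF M one u_int, of x "u x" "-1"] inc that
      by (simp add: kernel_op_def[of _ _ "\<lambda>y. u x - u y"] w_def)
    have 2: "(LINT y|?M. ?k' x y * (a x - u y)) = h x - kernel_op ?M ?k' u x" if "x \<in> frontier \<Omega>" for x
      using kK.kernel_op_lincomb[OF M one u_int, of x "a x" "-1"] inc that
      by (simp add: kernel_op_def[of _ _ "\<lambda>y. a x - u y"] h_def)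
    have 3: "2 * (LINT y|?S. ?l x y * b y) = g x" for x by (simp add: g_def kernel_op_def)
    have "(LINT x|?M. (1 / \<delta>\<^sup>2 * (LINT y|?M. ?k x y * (u x - u y)) - g x)\<^sup>2)
        = (LINT x|?M. (1 / \<delta>\<^sup>2 * (w x * u x - kernel_op ?M ?k u x) - g x)\<^sup>2)"
      by (intro Bochner_Integration.integral_cong) (auto simp: space_volume_on 1)
    moreover have "(LINT x|?S. (LINT y|?M. ?k' x y * (a x - u y))\<^sup>2)
        = (LINT x|?S. (h x - kernel_op ?M ?k' u x)\<^sup>2)"
      by (intro Bochner_Integration.integral_cong) (auto simp: space_surface_on 2)
    ultimately show ?thesis
      unfolding nonlocal_functional_def boundary_penalty_def 3 by simp
  qed
  let ?\<Phi> = "\<lambda>u. (LINT x|?M. (1 / \<delta>\<^sup>2 * (w x * u x - kernel_op ?M ?k u x) - g x)\<^sup>2)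
      - 2 * (LINT x|?M. f x * u x) + 1 / \<xi> * (LINT x|?S. (h x - kernel_op ?M ?k' u x)\<^sup>2)"
  have arg_min: "is_arg_min (nonlocal_functional \<Omega> K R \<delta> \<xi> f a b) (\<lambda>v. v \<in> square_integrable ?M) u
      \<longleftrightarrow> is_arg_min ?\<Phi> (\<lambda>v. v \<in> square_integrable ?M) u" for u
    by (rule is_arg_min_cong) (rule eq)
  have pos: "1 / \<delta>\<^sup>2 > 0" "1 / \<xi> > 0" using \<delta> \<xi> by simp_all
  show ?thesis
    unfolding arg_min
  proof (rule kernel_functional_arg_min[OF kR kK M S w w_pos pos _ f g h])
    show "AE x in ?M. v x = 0"
      if "continuous_on (closure \<Omega>) v" "\<And>x. x \<in> closure \<Omega> \<Longrightarrow> w x * v x = kernel_op ?M ?k v x"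
        "AE x in ?S. kernel_op ?M ?k' v x = 0" for v
      using nonlocal_operators_injective[OF dom R K R_nonzero K_nonzero \<delta>] that unfolding w_def by blast
  qed
qed

end
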